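(* Let $d\ge 3$, $m\in\mathbb{N}_0$, $n=d+m(d-2)$, let $\mathcal{T}$ be a $d$-angulation of the convex $n$-gon $\mathcal{P}_n$ and let $M_\mathcal{T}=(m_{i,j})$ be its matrix of numbers of $d$-paths. For boundary edges $e=(i,i+1)$ and $f=(j,j+1)$ of $\mathcal{P}_n$ put $$d(e,f)=\det\begin{pmatrix} m_{i,j} & m_{i,j+1}\\ m_{i+1,j} & m_{i+1,j+1}\end{pmatrix},$$ indices modulo $n$. Then: (a) $d(e,e)=-1$ for every boundary edge $e$; (b) $d(e,f)\in\{0,1\}$ for all boundary edges $e\neq f$; (c) for boundary edges $e\neq f$, $d(e,f)=1$ if and only if there is a sequence $e=z_0,z_1,\dots,z_{s-1},z_s=f$ ($s\ge 1$), where $z_1,\dots,z_{s-1}$ are diagonals of $\mathcal{T}$, such that for every $k\in\{0,1,\dots,s-1\}$: (i) $z_k$ and $z_{k+1}$ both lie on the boundary of a common $d$-gon $p_k$ of $\mathcal{T}$; (ii) the $d$-gons $p_0,\dots,p_{s-1}$ are pairwise different; (iii) $z_k$ and $z_{k+1}$ share an endpoint.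
   Context: $\mathcal{P}_n$ has vertices $1,\dots,n$ in counterclockwise order, labels modulo $n$; its boundary edges are $(i,i+1)$. A $d$-angulation is a dissection by pairwise non-crossing diagonals into $d$-gons. For vertices $i,j$, a (counterclockwise) $d$-path from $i$ to $j$ is a sequence $p_{i+1},\dots,p_{j-1}$ of $d$-gons of $\mathcal{T}$, indexed by the vertices met strictly between $i$ and $j$ going counterclockwise from $i$ to $j$ (empty if $j=i+1$; the $n-1$ vertices other than $i$ if $j=i$), such that (i) $p_k$ is incident to vertex $k$ for each such $k$ and (ii) each $d$-gon appears at most $d-2$ times; $m_{i,j}$ is the number of such $d$-paths. *)

theory Defs
  imports "HOL-Analysis.Determinants" "HOL-Library.FuncSet"
begin

text \<open>
  The vertices of the \<open>n\<close>-gon are the residues \<open>0, \<dots>, n - 1\<close> in counterclockwise order, so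
  the vertex usually labelled \<open>n\<close> is \<open>0\<close>. A diagonal is the set of its two endpoints, and a
  piece of a dissection is the set of its vertices, which determines a convex polygon.
\<close>

text \<open>The number of steps is in \<open>{1..n}\<close>: going from \<open>i\<close> to \<open>i\<close> is a full turn.\<close>

definition ccw_steps :: "nat \<Rightarrow> nat \<Rightarrow> nat \<Rightarrow> nat" where
  "ccw_steps n i j = (if i = j then n else (j + n - i) mod n)"

definition strictly_between :: "nat \<Rightarrow> nat \<Rightarrow> nat \<Rightarrow> nat set" where
  "strictly_between n i j = {(i + t) mod n | t. 0 < t \<and> t < ccw_steps n i j}"

definition boundary_edges :: "nat \<Rightarrow> (nat \<times> nat) set" where
  "boundary_edges n = {(i, (i + 1) mod n) | i. i < n}"

definition endpoints :: "nat \<times> nat \<Rightarrow> nat set" where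
  "endpoints e = {fst e, snd e}"

definition diagonals :: "nat \<Rightarrow> nat set set" where
  "diagonals n = {{a, b} | a b. a < n \<and> b < n \<and> a \<noteq> b} - endpoints ` boundary_edges n"

definition crossing :: "nat \<Rightarrow> nat set \<Rightarrow> nat set \<Rightarrow> bool" where
  "crossing n x y \<longleftrightarrow> (\<exists>a b u v. x = {a, b} \<and> y = {u, v} \<and>
     u \<in> strictly_between n a b \<and> v \<in> strictly_between n b a)"

definition dissection :: "nat \<Rightarrow> nat set set \<Rightarrow> bool" where
  "dissection n T \<longleftrightarrow> T \<subseteq> diagonals n \<and> (\<forall>x\<in>T. \<forall>y\<in>T. \<not> crossing n x y)"

definition sides :: "nat \<Rightarrow> nat set \<Rightarrow> nat set set" where
  "sides n P = {{a, b} | a b. a \<in> P \<and> b \<in> P \<and> a \<noteq> b \<and> strictly_between n a b \<inter> P = {}}"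

text \<open>
  The polygons into which a dissection \<open>T\<close> cuts the \<open>n\<close>-gon: every side is a boundary edge or
  a diagonal of \<open>T\<close>, and no diagonal of \<open>T\<close> cuts the polygon further. (A diagonal of \<open>T\<close> that
  meets the interior without joining two vertices of \<open>P\<close> would cross a side of \<open>P\<close> lying in \<open>T\<close>.)
\<close>

definition pieces :: "nat \<Rightarrow> nat set set \<Rightarrow> nat set set" where
  "pieces n T = {P. P \<subseteq> {..<n} \<and> 3 \<le> card P \<and>
     sides n P \<subseteq> T \<union> endpoints ` boundary_edges n \<and>
     (\<forall>z\<in>T. z \<subseteq> P \<longrightarrow> z \<in> sides n P)}"

definition angulation :: "nat \<Rightarrow> nat \<Rightarrow> nat set set \<Rightarrow> bool" where
  "angulation n d T \<longleftrightarrow> dissection n T \<and> (\<forall>P\<in>pieces n T. card P = d)"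

text \<open>
  A \<open>d\<close>-path is a function from the vertices strictly between \<open>i\<close> and \<open>j\<close> to the pieces,
  extensional (\<open>undefined\<close> elsewhere) so that counting functions counts sequences.
\<close>

definition d_paths :: "nat \<Rightarrow> nat \<Rightarrow> nat set set \<Rightarrow> nat \<Rightarrow> nat \<Rightarrow> (nat \<Rightarrow> nat set) set" where
  "d_paths n d T i j =
     {p \<in> (\<Pi>\<^sub>E k\<in>strictly_between n i j. {P \<in> pieces n T. k \<in> P}).
        \<forall>P\<in>pieces n T. card {k \<in> strictly_between n i j. p k = P} \<le> d - 2}"

definition num_paths :: "nat \<Rightarrow> nat \<Rightarrow> nat set set \<Rightarrow> nat \<Rightarrow> nat \<Rightarrow> int" where
  "num_paths n d T i j = int (card (d_paths n d T i j))"

definition edge_det :: "nat \<Rightarrow> nat \<Rightarrow> nat set set \<Rightarrow> nat \<times> nat \<Rightarrow> nat \<times> nat \<Rightarrow> int" where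
  "edge_det n d T e f =
     det (vector [vector [num_paths n d T (fst e) (fst f), num_paths n d T (fst e) (snd f)],
                  vector [num_paths n d T (snd e) (fst f), num_paths n d T (snd e) (snd f)]]
            :: int ^ 2 ^ 2)"

end

(* Cut an ear off along a shortest diagonal {a, b} and let I be the ear's inner vertices. The numbers
   m_{i,j} between the remaining vertices do not change, while m_{x,j} = m_{a,j} + m_{b,j} for x in I,
   and all m_{x,y} with x and y distinct vertices of the ear are 1. Hence crossing the ear from one of
   its outer edges to {a, b} preserves the determinant if the two share an endpoint and gives 0
   otherwise, which is the recursion satisfied by the walks of part (c). *)

theory Submission imports Defs begin

section \<open>Assigning vertices to pieces\<close>

text \<open>Everything rests on capacities. The \<open>d - 2\<close> inner vertices of an ear lie in
  no other piece, and \<open>d - 2\<close> is also the number of times that a piece may be used. An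
  arc between old vertices that passes the ear therefore fills it completely, and \<open>a\<close>
  and \<open>b\<close> remain a matter of the old pieces. An arc with one end at an inner vertex
  leaves the ear at least one slot; giving it to the nearby vertex among \<open>a\<close>,
  \<open>b\<close> or not produces the two summands of the recursion. Between two inner vertices the
  long way round a global count decides: the old pieces can hold all old vertices but two, so
  \<open>a\<close> and \<open>b\<close> both go to the ear and the number from \<open>b\<close> to
  \<open>a\<close> remains. Hence the values on reversed edges need an induction of their own. For
  walks the obstacle is a detour into the ear and back. Only one old piece has the side
  \<open>{a, b}\<close>, so the detour would repeat a piece.\<close>

definition assignments :: "nat \<Rightarrow> 'a set set \<Rightarrow> 'a set \<Rightarrow> ('a \<Rightarrow> 'a set) set" where
  "assignments c \<P> A =
     {p \<in> (\<Pi>\<^sub>E k\<in>A. {Q \<in> \<P>. k \<in> Q}). \<forall>Q\<in>\<P>. card {k \<in> A. p k = Q} \<le> c}"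

definition assign_count :: "nat \<Rightarrow> 'a set set \<Rightarrow> 'a set \<Rightarrow> nat" where
  "assign_count c \<P> A = card (assignments c \<P> A)"

lemma finite_assignments:
  assumes "finite A" "finite \<P>"
  shows "finite (assignments c \<P> A)"
proof (rule finite_subset)
  show "assignments c \<P> A \<subseteq> (\<Pi>\<^sub>E k\<in>A. {Q \<in> \<P>. k \<in> Q})"
    by (auto simp: assignments_def)
  show "finite (\<Pi>\<^sub>E k\<in>A. {Q \<in> \<P>. k \<in> Q})"
    using assms by (intro finite_PiE) auto
qed

lemma assign_count_empty [simp]: "assign_count c \<P> {} = 1"
proof -
  have "assignments c \<P> {} = {\<lambda>_. undefined}"
    by (auto simp: assignments_def)
  then show ?thesis by (simp add: assign_count_def)
qed

lemma assign_count_uncovered: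
  assumes "k \<in> A" "k \<notin> \<Union>\<P>"
  shows "assign_count c \<P> A = 0"
proof -
  have "assignments c \<P> A = {}"
    using assms by (auto simp: assignments_def PiE_def Pi_def)
  then show ?thesis by (simp add: assign_count_def)
qed

text \<open>Pigeonhole over the pieces. It yields the zero for a full turn and discards the terms
  that leave too many vertices to the old pieces.\<close>

lemma assign_count_over_capacity:
  assumes "finite A" "finite \<P>" "c * card \<P> < card A"
  shows "assign_count c \<P> A = 0"
proof -
  have False if p: "p \<in> assignments c \<P> A" for p
  proof -
    have "A = (\<Union>Q\<in>\<P>. {k \<in> A. p k = Q})"
      using p by (auto simp: assignments_def PiE_def Pi_def)
    then have "card A \<le> (\<Sum>Q\<in>\<P>. card {k \<in> A. p k = Q})"
      using card_UN_le[OF assms(2), of "\<lambda>Q. {k \<in> A. p k = Q}"] by simp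
    also have "\<dots> \<le> (\<Sum>Q\<in>\<P>. c)"
      using p by (intro sum_mono) (auto simp: assignments_def)
    finally show False using assms(3) by (simp add: mult.commute)
  qed
  then have "assignments c \<P> A = {}" by blast
  then show ?thesis by (simp add: assign_count_def)
qed

text \<open>Sort the assignments by the set of vertices that receive the new piece.\<close>

lemma assign_count_insert:
  assumes fin: "finite A" "finite \<P>" and P: "P \<notin> \<P>"
  shows "assign_count c (insert P \<P>) A =
    (\<Sum>X | X \<subseteq> A \<inter> P \<and> card X \<le> c. assign_count c \<P> (A - X))"
proof -
  let ?Xs = "{X. X \<subseteq> A \<inter> P \<and> card X \<le> c}"
  let ?S = "Sigma ?Xs (\<lambda>X. assignments c \<P> (A - X))"
  let ?f = "\<lambda>p. ({k \<in> A. p k = P}, restrict p {k \<in> A. p k \<noteq> P})"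
  let ?g = "\<lambda>(X, q) k. if k \<in> X then P else q k"
  have "bij_betw ?f (assignments c (insert P \<P>) A) ?S"
  proof (rule bij_betw_byWitness[where f' = ?g])
    show "\<forall>p\<in>assignments c (insert P \<P>) A. ?g (?f p) = p"
      by (auto simp: assignments_def fun_eq_iff PiE_def extensional_def)
    show "\<forall>q\<in>?S. ?f (?g q) = q"
    proof (rule ballI)
      fix Xq
      assume "Xq \<in> ?S"
      then obtain X q where Xq: "Xq = (X, q)" and X: "X \<subseteq> A \<inter> P" "card X \<le> c" and q: "q \<in> assignments c \<P> (A - X)"
        by auto
      have "q k \<noteq> P" if "k \<in> A - X" for k
        using q that P by (auto simp: assignments_def PiE_def Pi_def)
      moreover have "q k = undefined" if "k \<notin> A - X" for k
        using q that by (auto simp: assignments_def PiE_def extensional_def)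
      ultimately show "?f (?g Xq) = Xq"
        using X Xq by (auto simp: fun_eq_iff)
    qed
    show "?f ` assignments c (insert P \<P>) A \<subseteq> ?S"
    proof (rule image_subsetI)
      fix p
      assume p: "p \<in> assignments c (insert P \<P>) A"
      have "{k \<in> A - {k \<in> A. p k = P}. restrict p {k \<in> A. p k \<noteq> P} k = Q} = {k \<in> A. p k = Q}"
        if "Q \<in> \<P>" for Q
        using that P by auto
      then have "restrict p {k \<in> A. p k \<noteq> P} \<in> assignments c \<P> (A - {k \<in> A. p k = P})"
        using p by (auto simp: assignments_def PiE_def Pi_def extensional_def)
      moreover have "{k \<in> A. p k = P} \<subseteq> A \<inter> P" "card {k \<in> A. p k = P} \<le> c"
        using p by (auto simp: assignments_def PiE_def Pi_def)
      ultimately show "?f p \<in> ?S" by simp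
    qed
    show "?g ` ?S \<subseteq> assignments c (insert P \<P>) A"
    proof (rule image_subsetI)
      fix Xq
      assume "Xq \<in> ?S"
      then obtain X q where Xq: "Xq = (X, q)" and X: "X \<subseteq> A \<inter> P" "card X \<le> c" and q: "q \<in> assignments c \<P> (A - X)"
        by auto
      have nP: "q k \<noteq> P" if "k \<in> A - X" for k
        using q that P by (auto simp: assignments_def PiE_def Pi_def)
      have "{k \<in> A. ?g (X, q) k = P} = X" using X nP by auto
      moreover have "{k \<in> A. ?g (X, q) k = Q} = {k \<in> A - X. q k = Q}" if "Q \<in> \<P>" for Q
        using that P by auto
      ultimately show "?g Xq \<in> assignments c (insert P \<P>) A"
        using q X Xq by (auto simp: assignments_def PiE_def Pi_def extensional_def)
    qed
  qed
  then have "assign_count c (insert P \<P>) A = card ?S"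
    unfolding assign_count_def by (rule bij_betw_same_card)
  also have "\<dots> = (\<Sum>X\<in>?Xs. assign_count c \<P> (A - X))"
    unfolding assign_count_def using fin
    by (intro card_SigmaI) (auto intro: finite_assignments)
  finally show ?thesis .
qed

text \<open>The vertices in \<open>I\<close> lie in no other piece, so all of them must receive the new one.\<close>

lemma assign_count_ear:
  assumes fin: "finite A" "finite \<P>" and ab: "a \<notin> I" "b \<notin> I" and I: "I \<inter> \<Union>\<P> = {}" "I \<noteq> {}"
  shows "assign_count c (insert (insert a (insert b I)) \<P>) A =
    (\<Sum>Y | Y \<subseteq> A \<inter> {a, b} \<and> card (A \<inter> I) + card Y \<le> c. assign_count c \<P> (A - I - Y))"
    (is "?L = ?R")
proof -
  let ?P = "insert a (insert b I)"
  have "?P \<notin> \<P>" using I by blast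
  then have "?L = (\<Sum>X | X \<subseteq> A \<inter> ?P \<and> card X \<le> c. assign_count c \<P> (A - X))"
    by (rule assign_count_insert[OF fin])
  also have "\<dots> = (\<Sum>X | X \<subseteq> A \<inter> ?P \<and> card X \<le> c \<and> A \<inter> I \<subseteq> X. assign_count c \<P> (A - X))"
  proof (rule sum.mono_neutral_right)
    show "finite {X. X \<subseteq> A \<inter> ?P \<and> card X \<le> c}"
      using fin(1) by (auto intro: finite_subset[of _ "Pow A"])
    show "\<forall>X\<in>{X. X \<subseteq> A \<inter> ?P \<and> card X \<le> c} - {X. X \<subseteq> A \<inter> ?P \<and> card X \<le> c \<and> A \<inter> I \<subseteq> X}.
        assign_count c \<P> (A - X) = 0"
    proof
      fix X
      assume "X \<in> {X. X \<subseteq> A \<inter> ?P \<and> card X \<le> c} - {X. X \<subseteq> A \<inter> ?P \<and> card X \<le> c \<and> A \<inter> I \<subseteq> X}"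
      then obtain k where "k \<in> A - X" "k \<in> I" by auto
      then show "assign_count c \<P> (A - X) = 0"
        using I by (intro assign_count_uncovered) auto
    qed
  qed auto
  also have "\<dots> = ?R"
  proof (rule sum.reindex_bij_witness[where i = "\<lambda>Y. A \<inter> I \<union> Y" and j = "\<lambda>X. X - I"])
    fix X
    assume X: "X \<in> {X. X \<subseteq> A \<inter> ?P \<and> card X \<le> c \<and> A \<inter> I \<subseteq> X}"
    then show eq: "A \<inter> I \<union> (X - I) = X" by auto
    have "finite X" using X fin(1) by (auto intro: finite_subset)
    moreover have "A \<inter> I \<inter> (X - I) = {}" by auto
    ultimately have "card (A \<inter> I) + card (X - I) = card X"
      using eq fin(1) card_Un_disjoint[of "A \<inter> I" "X - I"] by simp
    then show "X - I \<in> {Y. Y \<subseteq> A \<inter> {a, b} \<and> card (A \<inter> I) + card Y \<le> c}" using X by auto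
    show "assign_count c \<P> (A - I - (X - I)) = assign_count c \<P> (A - X)"
      using X by (intro arg_cong[where f = "assign_count c \<P>"]) auto
  next
    fix Y
    assume Y: "Y \<in> {Y. Y \<subseteq> A \<inter> {a, b} \<and> card (A \<inter> I) + card Y \<le> c}"
    then show "A \<inter> I \<union> Y - I = Y" using ab by auto
    have "card (A \<inter> I \<union> Y) \<le> card (A \<inter> I) + card Y" by (rule card_Un_le)
    then show "A \<inter> I \<union> Y \<in> {X. X \<subseteq> A \<inter> ?P \<and> card X \<le> c \<and> A \<inter> I \<subseteq> X}"
      using Y by auto
  qed
  finally show ?thesis .
qed

text \<open>The inner vertices exhaust the capacity, so neither \<open>a\<close> nor
  \<open>b\<close> can be given to the new piece.\<close>

lemma assign_count_ear_full:
  assumes "finite A" "finite \<P>" "a \<notin> I" "b \<notin> I" "I \<inter> \<Union>\<P> = {}" "I \<noteq> {}" "card (A \<inter> I) = c"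
  shows "assign_count c (insert (insert a (insert b I)) \<P>) A = assign_count c \<P> (A - I)"
proof -
  have "{Y. Y \<subseteq> A \<inter> {a, b} \<and> card (A \<inter> I) + card Y \<le> c} = {{}}"
    using assms(7) finite_subset[of _ "{a, b}"] by (auto simp: card_eq_0_iff)
  then show ?thesis using assign_count_ear[OF assms(1-6), of c] by simp
qed

lemma assign_count_ear_0:
  assumes "finite A" "finite \<P>" "a \<notin> I" "b \<notin> I" "I \<inter> \<Union>\<P> = {}" "I \<noteq> {}"
    and "A \<inter> {a, b} = {}" "card (A \<inter> I) \<le> c"
  shows "assign_count c (insert (insert a (insert b I)) \<P>) A = assign_count c \<P> (A - I)"
proof -
  have "{Y. Y \<subseteq> A \<inter> {a, b} \<and> card (A \<inter> I) + card Y \<le> c} = {{}}"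
    using assms(7,8) by auto
  then show ?thesis using assign_count_ear[OF assms(1-6), of c] by simp
qed

lemma assign_count_ear_1:
  assumes "finite A" "finite \<P>" "a \<notin> I" "b \<notin> I" "I \<inter> \<Union>\<P> = {}" "I \<noteq> {}"
    and "A \<inter> {a, b} = {v}" "card (A \<inter> I) < c"
  shows "assign_count c (insert (insert a (insert b I)) \<P>) A =
    assign_count c \<P> (A - I) + assign_count c \<P> (A - I - {v})"
proof -
  have "{Y. Y \<subseteq> A \<inter> {a, b} \<and> card (A \<inter> I) + card Y \<le> c} = {{}, {v}}"
    using assms(7,8) by (auto simp: subset_singleton_iff)
  then show ?thesis using assign_count_ear[OF assms(1-6), of c] by simp
qed

lemma assign_count_ear_2:
  assumes "finite A" "finite \<P>" "a \<notin> I" "b \<notin> I" "I \<inter> \<Union>\<P> = {}" "I \<noteq> {}"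
    and "a \<noteq> b" "{a, b} \<subseteq> A" "card (A \<inter> I) + 2 \<le> c"
  shows "assign_count c (insert (insert a (insert b I)) \<P>) A =
    assign_count c \<P> (A - I) + assign_count c \<P> (A - I - {a}) +
    assign_count c \<P> (A - I - {b}) + assign_count c \<P> (A - I - {a, b})"
proof -
  have eq: "{Y. Y \<subseteq> A \<inter> {a, b} \<and> card (A \<inter> I) + card Y \<le> c} = Pow {a, b}"
    (is "?Ys = _")
  proof (rule subset_antisym)
    show "Pow {a, b} \<subseteq> ?Ys"
    proof
      fix Y
      assume Y: "Y \<in> Pow {a, b}"
      then have "card Y \<le> 2" using card_mono[of "{a, b}" Y] assms(7) by simp
      then show "Y \<in> ?Ys" using Y assms(8,9) by auto
    qed
  qed auto
  show ?thesis
    unfolding assign_count_ear[OF assms(1-6), of c] eq using assms(7)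
    by (simp add: Pow_insert doubleton_eq_iff insert_commute)
qed

section \<open>Path numbers of a polygon glued from ears\<close>

text \<open>
  Vertices keep their labels when ears are cut off, so a polygon is any finite set of naturals
  in its cyclic order; arcs are unbounded and get intersected with it. As in
  \<open>ccw_steps\<close>, the arc from \<open>i\<close> to \<open>i\<close> is a full turn.
\<close>

definition arc :: "nat \<Rightarrow> nat \<Rightarrow> nat set" where
  "arc i j = (if i < j then {i<..<j} else {i<..} \<union> {..<j})"

lemma arc_iff: "k \<in> arc i j \<longleftrightarrow> (if i < j then i < k \<and> k < j else i < k \<or> k < j)"
  by (auto simp: arc_def)

text \<open>Counterclockwise pairs of cyclic neighbours in \<open>V\<close>. The same notion serves
  for the whole polygon and for a piece, whose neighbours may be far apart in the polygon.\<close>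

definition polygon_edges :: "nat set \<Rightarrow> (nat \<times> nat) set" where
  "polygon_edges V = {(x, y). x \<in> V \<and> y \<in> V \<and> x \<noteq> y \<and> arc x y \<inter> V = {}}"

definition polygon_sides :: "nat set \<Rightarrow> nat set set" where
  "polygon_sides V = endpoints ` polygon_edges V"

lemma polygon_edgesD:
  assumes "(x, y) \<in> polygon_edges V"
  shows "x \<in> V" "y \<in> V" "x \<noteq> y" "\<And>k. k \<in> V \<Longrightarrow> k \<notin> arc x y"
  using assms by (auto simp: polygon_edges_def)

text \<open>The cyclic successor is unique and so is the predecessor: of two candidates, one would
  lie in the arc that the other edge keeps empty.\<close>

lemma polygon_edges_trichotomy:
  assumes "(x, y) \<in> polygon_edges V" "(u, v) \<in> polygon_edges V"
  shows "x = u \<longleftrightarrow> y = v"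
proof -
  have "y \<notin> arc u v" "v \<notin> arc x y" "x \<notin> arc u v" "u \<notin> arc x y"
    using assms polygon_edgesD by blast+
  moreover have "x \<noteq> y" "u \<noteq> v" using assms polygon_edgesD by blast+
  ultimately show ?thesis by (auto simp: arc_iff split: if_splits)
qed

lemma polygon_sides_subset: "h \<in> polygon_sides V \<Longrightarrow> h \<subseteq> V"
  by (auto simp: polygon_sides_def polygon_edges_def endpoints_def)

definition path_num :: "nat \<Rightarrow> nat set \<Rightarrow> nat set set \<Rightarrow> nat \<Rightarrow> nat \<Rightarrow> int" where
  "path_num c V \<P> i j = int (assign_count c \<P> (arc i j \<inter> V))"

definition path_det :: "nat \<Rightarrow> nat set \<Rightarrow> nat set set \<Rightarrow> nat \<times> nat \<Rightarrow> nat \<times> nat \<Rightarrow> int" where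
  "path_det c V \<P> e f =
     path_num c V \<P> (fst e) (fst f) * path_num c V \<P> (snd e) (snd f) -
     path_num c V \<P> (fst e) (snd f) * path_num c V \<P> (snd e) (fst f)"

text \<open>Here \<open>c\<close> is \<open>d - 2\<close>, both the capacity of a piece and the number of inner vertices of an ear.\<close>

inductive glued :: "nat \<Rightarrow> nat set \<Rightarrow> nat set set \<Rightarrow> nat set set \<Rightarrow> bool" for c where
  single: "finite V \<Longrightarrow> 0 < c \<Longrightarrow> card V = c + 2 \<Longrightarrow> glued c V {} {V}"
| ear: "glued c V T \<P> \<Longrightarrow> a < b \<Longrightarrow> (a, b) \<in> polygon_edges V \<Longrightarrow> I \<subseteq> {a<..<b} \<Longrightarrow> card I = c \<Longrightarrow>
    glued c (V \<union> I) (insert {a, b} T) (insert (insert a (insert b I)) \<P>)"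

text \<open>Every ear contributes \<open>c\<close> vertices and one piece. The resulting equation
  for \<open>card V\<close> says that the pieces can absorb all vertices except two, which makes the
  capacity arguments sharp.\<close>

lemma glued_invariants:
  assumes "glued c V T \<P>"
  shows "finite V" "finite \<P>" "\<Union>\<P> \<subseteq> V" "\<Union>T \<subseteq> V" "0 < c" "card V = 2 + c * card \<P>" "\<P> \<noteq> {}"
proof -
  from assms have "finite V \<and> finite \<P> \<and> \<Union>\<P> \<subseteq> V \<and> \<Union>T \<subseteq> V \<and> 0 < c \<and> card V = 2 + c * card \<P> \<and> \<P> \<noteq> {}"
  proof induction
    case (single V)
    then show ?case by simp
  next
    case (ear V T \<P> a b I)
    then have "finite I" "I \<noteq> {}" by (auto intro: finite_subset)
    have "I \<subseteq> arc a b" using ear.hyps by (simp add: arc_def)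
    then have VI: "V \<inter> I = {}" using ear.hyps by (auto simp: polygon_edges_def)
    then have "insert a (insert b I) \<notin> \<P>" using ear.IH \<open>I \<noteq> {}\<close> by blast
    then show ?case
      using ear VI \<open>finite I\<close> card_Un_disjoint[of V I] by (auto simp: polygon_edges_def)
  qed
  then show "finite V" "finite \<P>" "\<Union>\<P> \<subseteq> V" "\<Union>T \<subseteq> V" "0 < c" "card V = 2 + c * card \<P>" "\<P> \<noteq> {}"
    by auto
qed

lemma glued_card_ge_3:
  assumes "glued c V T \<P>"
  shows "3 \<le> card V"
proof -
  have "0 < c" "0 < card \<P>" using glued_invariants[OF assms] by (auto simp: card_gt_0_iff)
  then have "0 < c * card \<P>" by simp
  then show ?thesis using glued_invariants(6)[OF assms] by linarith
qed

text \<open>The capacity is \<open>card V - 2\<close>: an arc between distinct vertices omits both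
  of them and fits, a full turn omits only one vertex and does not.\<close>

lemma path_num_single:
  assumes "finite V" "card V = c + 2" "x \<in> V" "y \<in> V"
  shows "path_num c V {V} x y = (if x = y then 0 else 1)"
proof (cases "x = y")
  case True
  then have "arc x y \<inter> V = V - {x}" by (auto simp: arc_iff)
  then show ?thesis
    using assms True assign_count_over_capacity[of "V - {x}" "{V}" c]
    by (simp add: path_num_def)
next
  case False
  let ?A = "arc x y \<inter> V"
  have "?A \<subseteq> V - {x, y}" by (auto simp: arc_iff split: if_splits)
  then have "card ?A \<le> c"
    using card_mono[of "V - {x, y}" ?A] assms False by simp
  have fin: "finite ?A" using assms by simp
  have "assign_count c {V} ?A = (\<Sum>X | X \<subseteq> ?A \<inter> V \<and> card X \<le> c. assign_count c {} (?A - X))"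
    using assign_count_insert[of ?A "{}" V c] fin by simp
  also have "\<dots> = (\<Sum>X\<in>{?A}. assign_count c {} (?A - X))"
  proof (rule sum.mono_neutral_right)
    show "finite {X. X \<subseteq> ?A \<inter> V \<and> card X \<le> c}"
      using fin by (auto intro: finite_subset[of _ "Pow ?A"])
    show "\<forall>X\<in>{X. X \<subseteq> ?A \<inter> V \<and> card X \<le> c} - {?A}. assign_count c {} (?A - X) = 0"
    proof
      fix X
      assume "X \<in> {X. X \<subseteq> ?A \<inter> V \<and> card X \<le> c} - {?A}"
      then obtain k where "k \<in> ?A - X" by blast
      then show "assign_count c {} (?A - X) = 0" by (rule assign_count_uncovered) simp
    qed
  qed (use \<open>card ?A \<le> c\<close> in auto)
  also have "\<dots> = 1" by simp
  finally show ?thesis using False by (simp add: path_num_def)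
qed

text \<open>A full turn has \<open>card V - 1\<close> vertices, one more than the total
  capacity.\<close>

lemma path_num_self:
  assumes "glued c V T \<P>" "i \<in> V"
  shows "path_num c V \<P> i i = 0"
proof -
  have "arc i i \<inter> V = V - {i}" by (auto simp: arc_iff)
  then show ?thesis
    using glued_invariants[OF assms(1)] assms(2) assign_count_over_capacity[of "V - {i}" \<P> c]
    by (simp add: path_num_def)
qed

lemma path_num_edge:
  assumes "(x, y) \<in> polygon_edges V"
  shows "path_num c V \<P> x y = 1"
  using assms by (simp add: path_num_def polygon_edges_def)

section \<open>Path numbers after gluing one ear\<close>

locale ear_gluing =
  fixes c V T \<P> a b I
  assumes old: "glued c V T \<P>" and ab: "a < b" "(a, b) \<in> polygon_edges V"
    and I: "I \<subseteq> {a<..<b}" "card I = c"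
begin

abbreviation "W \<equiv> V \<union> I"
abbreviation "P \<equiv> insert a (insert b I)"
abbreviation "\<Q> \<equiv> insert P \<P>"
abbreviation "T' \<equiv> insert {a, b} T"

lemmas inv = glued_invariants[OF old]

lemma new: "glued c W T' \<Q>"
  by (rule glued.ear[OF old ab I])

lemma I_nonempty: "I \<noteq> {}" using inv(5) I(2) by auto

lemma finite_I: "finite I" using I(1) by (rule finite_subset) simp

lemma a_in: "a \<in> V" and b_in: "b \<in> V" using ab polygon_edgesD by blast+

lemma V_outside: "v \<in> V \<Longrightarrow> v \<le> a \<or> b \<le> v"
  using ab polygon_edgesD(4)[OF ab(2), of v] by (auto simp: arc_iff)

lemma I_inside: "x \<in> I \<Longrightarrow> a < x" "x \<in> I \<Longrightarrow> x < b" "x \<in> I \<Longrightarrow> x \<notin> V"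
  using I(1) V_outside[of x] by auto

lemma disjoint: "V \<inter> I = {}" "a \<notin> I" "b \<notin> I" "I \<inter> \<Union>\<P> = {}"
  using I_inside inv(3) by blast+

lemma P_notin: "P \<notin> \<P>" using disjoint I_nonempty by blast

lemma finite_arc: "finite (arc i j \<inter> W)" using inv(1) finite_I by simp

text \<open>Seen from old vertices the ear is all or nothing: the arc contains all of
  \<open>I\<close>, which saturates the ear, or it misses the ear together with \<open>a\<close> and
  \<open>b\<close>.\<close>

lemma path_num_old:
  assumes "i \<in> V" "j \<in> V"
  shows "path_num c W \<Q> i j = path_num c V \<P> i j"
proof -
  let ?A = "arc i j \<inter> W"
  have out: "i \<le> a \<or> b \<le> i" "j \<le> a \<or> b \<le> j" using assms V_outside by auto
  have diff: "?A - I = arc i j \<inter> V" using disjoint by auto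
  obtain w where w: "w \<in> I" using I_nonempty by auto
  show ?thesis
  proof (cases "w \<in> arc i j")
    case True
    have "x \<in> arc i j" if "x \<in> I" for x
      using True out ab(1) I_inside[OF that] I_inside[OF w] by (auto simp: arc_iff split: if_splits)
    then have "?A \<inter> I = I" by auto
    then show ?thesis
      using assign_count_ear_full[OF finite_arc inv(2) disjoint(2-4) I_nonempty, of i j c] I(2) diff
      by (simp add: path_num_def)
  next
    case False
    have "x \<notin> arc i j" if "x \<in> P" for x
      using False that out ab(1) I_inside[of x] I_inside[OF w] by (auto simp: arc_iff split: if_splits)
    then have "?A \<inter> {a, b} = {}" "?A \<inter> I = {}" by auto
    then show ?thesis
      using assign_count_ear_0[OF finite_arc inv(2) disjoint(2-4) I_nonempty, of i j c] diff
      by (simp add: path_num_def)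
  qed
qed

text \<open>Since \<open>x\<close> is not on the arc, the ear keeps a free slot, and of
  \<open>a\<close>, \<open>b\<close> only \<open>b\<close> can be on the arc. If \<open>b\<close> is
  left to the old pieces, they serve the arc from \<open>a\<close> to \<open>j\<close>; if the ear
  takes \<open>b\<close>, they serve the arc from \<open>b\<close> to \<open>j\<close>.\<close>

lemma path_num_left:
  assumes "x \<in> I" "j \<in> V"
  shows "path_num c W \<Q> x j = path_num c V \<P> a j + path_num c V \<P> b j"
proof -
  let ?A = "arc x j \<inter> W"
  have x: "a < x" "x < b" using I_inside assms by auto
  have out: "j \<le> a \<or> b \<le> j" using assms V_outside by auto
  have "?A \<inter> I \<subseteq> I - {x}" by (auto simp: arc_iff split: if_splits)
  then have card: "card (?A \<inter> I) < c"
    using finite_I I(2) assms(1) by (metis card_seteq leI Diff_iff insertI1 finite_Int inf_le2 subset_iff)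
  show ?thesis
  proof (cases "j = b")
    \<comment> \<open>The arc stops before \<open>b\<close>, so there is no choice; the recursion
      reads \<open>1 = 1 + 0\<close>.\<close>
    case True
    have "?A \<inter> {a, b} = {}" "?A - I = {}"
      using True x by (auto simp: arc_iff dest: V_outside)
    then have "assign_count c \<P> (?A - I) = 1" by (simp only: assign_count_empty)
    then have "path_num c W \<Q> x j = 1"
      using \<open>?A \<inter> {a, b} = {}\<close> assign_count_ear_0[OF finite_arc inv(2) disjoint(2-4) I_nonempty, of x j c] card
      by (simp add: path_num_def)
    then show ?thesis
      using True path_num_edge[OF ab(2)] path_num_self[OF old b_in] by simp
  next
    case False
    have "?A \<inter> {a, b} = {b}" "?A - I = arc a j \<inter> V" "arc a j \<inter> V - {b} = arc b j \<inter> V"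
      using False x out ab a_in b_in I_inside V_outside
      by (force simp: arc_iff split: if_splits)+
    then show ?thesis
      using assign_count_ear_1[OF finite_arc inv(2) disjoint(2-4) I_nonempty, of x j b c] card
      by (simp add: path_num_def)
  qed
qed

text \<open>Mirror image of \<open>path_num_left\<close>, with the free slot offered to
  \<open>a\<close>.\<close>

lemma path_num_right:
  assumes "i \<in> V" "x \<in> I"
  shows "path_num c W \<Q> i x = path_num c V \<P> i a + path_num c V \<P> i b"
proof -
  let ?A = "arc i x \<inter> W"
  have x: "a < x" "x < b" using I_inside assms by auto
  have out: "i \<le> a \<or> b \<le> i" using assms V_outside by auto
  have "?A \<inter> I \<subseteq> I - {x}" by (auto simp: arc_iff split: if_splits)
  then have card: "card (?A \<inter> I) < c"
    using finite_I I(2) assms(2) by (metis card_seteq leI Diff_iff insertI1 finite_Int inf_le2 subset_iff)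
  show ?thesis
  proof (cases "i = a")
    case True
    have "?A \<inter> {a, b} = {}" "?A - I = {}"
      using True x by (auto simp: arc_iff dest: V_outside)
    then have "assign_count c \<P> (?A - I) = 1" by (simp only: assign_count_empty)
    then have "path_num c W \<Q> i x = 1"
      using \<open>?A \<inter> {a, b} = {}\<close> assign_count_ear_0[OF finite_arc inv(2) disjoint(2-4) I_nonempty, of i x c] card
      by (simp add: path_num_def)
    then show ?thesis
      using True path_num_edge[OF ab(2)] path_num_self[OF old a_in] by simp
  next
    case False
    have "?A \<inter> {a, b} = {a}" "?A - I = arc i b \<inter> V" "arc i b \<inter> V - {a} = arc i a \<inter> V"
      using False x out ab a_in b_in I_inside V_outside
      by (force simp: arc_iff split: if_splits)+
    then show ?thesis
      using assign_count_ear_1[OF finite_arc inv(2) disjoint(2-4) I_nonempty, of i x a c] card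
      by (simp add: path_num_def)
  qed
qed

text \<open>For \<open>x < y\<close> the arc stays inside the ear and leaves no choice; otherwise it
  contains all of \<open>V\<close>. The assumption \<open>ba\<close> is discharged later, by an
  induction that itself uses this lemma.\<close>

lemma path_num_inner:
  assumes "x \<in> I" "y \<in> I" "x \<noteq> y" and ba: "path_num c V \<P> b a = 1"
  shows "path_num c W \<Q> x y = 1"
proof -
  let ?A = "arc x y \<inter> W"
  have xy: "a < x" "x < b" "a < y" "y < b" using I_inside assms by auto
  have "?A \<inter> I \<subseteq> I - {x, y}" by (auto simp: arc_iff split: if_splits)
  then have "card (?A \<inter> I) \<le> card (I - {x, y})" using finite_I by (intro card_mono) auto
  moreover have "card (I - {x, y}) + 2 = c"
    using assms(1-3) finite_I I(2) card_mono[of I "{x, y}"] by (simp add: card_Diff_subset)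
  ultimately have card: "card (?A \<inter> I) + 2 \<le> c" by linarith
  show ?thesis
  proof (cases "x < y")
    case True
    have "?A \<inter> {a, b} = {}" "?A - I = {}"
      using True xy by (auto simp: arc_iff dest: V_outside)
    then have "assign_count c \<P> (?A - I) = 1" by (simp only: assign_count_empty)
    then show ?thesis
      using \<open>?A \<inter> {a, b} = {}\<close> assign_count_ear_0[OF finite_arc inv(2) disjoint(2-4) I_nonempty, of x y c] card
      by (simp add: path_num_def)
  next
    case False
    have sub: "{a, b} \<subseteq> ?A" using xy False a_in b_in by (auto simp: arc_iff)
    have V: "?A - I = V"
      using xy False disjoint V_outside by (force simp: arc_iff)
    have "V - {a, b} = arc b a \<inter> V"
      using ab V_outside by (force simp: arc_iff)
    \<comment> \<open>The old pieces hold at most \<open>card V - 2\<close> vertices, so the ear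
      must take both \<open>a\<close> and \<open>b\<close>; only the fourth summand
      survives.\<close>
    moreover have "assign_count c \<P> V = 0" "assign_count c \<P> (V - {a}) = 0"
      "assign_count c \<P> (V - {b}) = 0"
      using inv a_in b_in by (simp_all add: assign_count_over_capacity)
    ultimately show ?thesis
      using assign_count_ear_2[OF finite_arc inv(2) disjoint(2-4) I_nonempty _ sub card] ab ba V
      by (simp add: path_num_def)
  qed
qed

text \<open>The arc from \<open>a\<close> to \<open>b\<close> now contains \<open>I\<close>, so that
  edge disappears. An edge with an inner end cannot pass over \<open>a\<close> or \<open>b\<close>
  and hence belongs to the ear. The inductions below split along these two cases.\<close>

lemma edge_cases:
  assumes "(x, y) \<in> polygon_edges W"
  obtains "(x, y) \<in> polygon_edges V" "(x, y) \<noteq> (a, b)"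
  | "(x, y) \<in> polygon_edges P" "x < y" "x = a \<or> x \<in> I" "y = b \<or> y \<in> I" "x = a \<Longrightarrow> y \<noteq> b"
proof -
  note xy = polygon_edgesD[OF assms]
  obtain w where w: "w \<in> I" using I_nonempty by auto
  show thesis
  proof (cases "x \<in> V \<and> y \<in> V")
    case True
    have "(x, y) \<noteq> (a, b)" using xy(4)[of w] w I_inside[OF w] ab by (auto simp: arc_iff)
    then show thesis using that(1) True xy by (auto simp: polygon_edges_def)
  next
    case False
    have nab: "a \<notin> arc x y" "b \<notin> arc x y" using xy(4) a_in b_in by auto
    then have *: "x < y" "x = a \<or> x \<in> I" "y = b \<or> y \<in> I" "x = a \<Longrightarrow> y \<noteq> b"
      using nab xy(1-3) False I_inside[of x] I_inside[of y] V_outside[of x] V_outside[of y] a_in b_in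
      by (auto simp: arc_iff split: if_splits)
    moreover have "(x, y) \<in> polygon_edges P"
      using * xy a_in b_in by (auto simp: polygon_edges_def)
    ultimately show thesis using that(2) by blast
  qed
qed

end

text \<open>Induction along the gluing: an ear edge at \<open>a\<close> or \<open>b\<close> gets
  \<open>0 + 1\<close> or \<open>1 + 0\<close> from the recursion, and an edge between inner
  vertices gets the value for \<open>(b, a)\<close>, known by induction for
  \<open>(a, b)\<close>.\<close>

lemma path_num_edge_rev:
  assumes "glued c V T \<P>" "(x, y) \<in> polygon_edges V"
  shows "path_num c V \<P> y x = 1"
  using assms
proof (induction arbitrary: x y)
  case (single V)
  then show ?case using path_num_single[of V c y x] by (auto simp: polygon_edges_def)
next
  case (ear V T \<P> a b I)
  then interpret ear_gluing c V T \<P> a b I by unfold_locales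
  from ear.prems show ?case
  proof (cases rule: edge_cases)
    case 1
    then show ?thesis using ear.IH path_num_old polygon_edgesD by simp
  next
    case 2
    then show ?thesis
      using ear.IH[OF ab(2)] path_num_left[of y a] path_num_right[of b x] path_num_inner[of y x]
        a_in b_in path_num_self[OF old] by auto
  qed
qed

lemma (in ear_gluing) path_num_on_ear:
  assumes "x \<in> P" "y \<in> P"
  shows "path_num c W \<Q> x y = (if x = y then 0 else 1)"
proof (cases "x = y")
  case True
  then show ?thesis using path_num_self[OF new] assms a_in b_in by auto
next
  case False
  have [simp]: "path_num c V \<P> a b = 1" "path_num c V \<P> b a = 1"
    "path_num c V \<P> a a = 0" "path_num c V \<P> b b = 0"
    using path_num_edge[OF ab(2)] path_num_edge_rev[OF old ab(2)] path_num_self[OF old] a_in b_in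
    by auto
  show ?thesis
    using False assms a_in b_in path_num_old path_num_left path_num_right path_num_inner by auto
qed

text \<open>The two arcs are complementary, so there is no evident bijection; but the left and right
  recursions are mirror images of each other, which carries symmetry through the induction.\<close>

lemma path_num_sym:
  assumes "glued c V T \<P>" "i \<in> V" "j \<in> V"
  shows "path_num c V \<P> i j = path_num c V \<P> j i"
  using assms
proof (induction arbitrary: i j)
  case (single V)
  then show ?case using path_num_single by simp
next
  case (ear V T \<P> a b I)
  then interpret ear_gluing c V T \<P> a b I by unfold_locales
  consider "i \<in> V" "j \<in> V" | "i \<in> I" "j \<in> V" | "i \<in> V" "j \<in> I" | "i \<in> I" "j \<in> I"
    using ear.prems by blast
  then show ?case
    by cases (use ear.IH a_in b_in path_num_old path_num_left path_num_right path_num_on_ear in auto)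
qed

lemma path_det_sym:
  assumes "glued c V T \<P>" "e \<in> polygon_edges V" "f \<in> polygon_edges V"
  shows "path_det c V \<P> e f = path_det c V \<P> f e"
proof -
  have "fst e \<in> V" "snd e \<in> V" "fst f \<in> V" "snd f \<in> V"
    using assms by (auto simp: polygon_edges_def)
  then show ?thesis
    using path_num_sym[OF assms(1)] by (simp add: path_det_def mult.commute)
qed

text \<open>The diagonal entries are full turns and the other two are edge values, so the
  determinant is \<open>0 * 0 - 1 * 1\<close>.\<close>

lemma path_det_self:
  assumes "glued c V T \<P>" "e \<in> polygon_edges V"
  shows "path_det c V \<P> e e = - 1"
proof -
  obtain x y where e: "e = (x, y)" by force
  then show ?thesis
    using assms polygon_edgesD[of x y V] path_num_self[OF assms(1)] path_num_edge[of x y V]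
      path_num_edge_rev[OF assms(1), of x y]
    by (simp add: path_det_def)
qed

section \<open>Determinants and walks\<close>

text \<open>The list records the pieces in order, with the sides between them left implicit. In this
  form the first crossing can be peeled off, and \<open>Q \<notin> set ps\<close> expresses that the
  pieces are pairwise different.\<close>

inductive walk :: "nat set set \<Rightarrow> nat set set \<Rightarrow> nat set \<Rightarrow> nat set list \<Rightarrow> nat set \<Rightarrow> bool"
  for T \<P> where
  last: "Q \<in> \<P> \<Longrightarrow> e \<in> polygon_sides Q \<Longrightarrow> f \<in> polygon_sides Q \<Longrightarrow> e \<inter> f \<noteq> {} \<Longrightarrow> walk T \<P> e [Q] f"
| step: "Q \<in> \<P> \<Longrightarrow> e \<in> polygon_sides Q \<Longrightarrow> h \<in> polygon_sides Q \<Longrightarrow> e \<inter> h \<noteq> {} \<Longrightarrow> h \<in> T \<Longrightarrow>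
    Q \<notin> set ps \<Longrightarrow> walk T \<P> h ps f \<Longrightarrow> walk T \<P> e (Q # ps) f"

lemma walk_hd:
  "walk T \<P> e ps f \<Longrightarrow> ps \<noteq> [] \<and> hd ps \<in> \<P> \<and> e \<in> polygon_sides (hd ps)"
  by (cases rule: walk.cases) auto

lemma walk_snoc:
  assumes "walk T \<P> e ps h" "h \<in> T" "Q \<in> \<P>" "h \<in> polygon_sides Q" "f \<in> polygon_sides Q"
    "h \<inter> f \<noteq> {}" "Q \<notin> set ps"
  shows "walk T \<P> e (ps @ [Q]) f"
  using assms
proof (induction rule: walk.induct)
  case (last Q' e h)
  then have "walk T \<P> h [Q] f" by (intro walk.last)
  then show ?case using last by (auto intro!: walk.step[of Q' \<P> e h])
next
  case (step Q' e h' ps h)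
  then show ?case by (auto intro!: walk.step[of Q' \<P> e h'])
qed

text \<open>Reversal lets a pair of an old and an ear edge be treated in one order only, and gives
  access to the last piece.\<close>

lemma walk_rev: "walk T \<P> e ps f \<Longrightarrow> walk T \<P> f (rev ps) e"
proof (induction rule: walk.induct)
  case (last Q e f)
  then show ?case using walk.last[of Q \<P> f e T] by (simp add: Int_commute)
next
  case (step Q e h ps f)
  then show ?case using walk_snoc[of T \<P> f "rev ps" h Q e] by (simp add: Int_commute)
qed

lemma walk_last: "walk T \<P> e ps f \<Longrightarrow> f \<in> polygon_sides (last ps)"
  using walk_hd[OF walk_rev] by (metis hd_rev rev_is_Nil_conv)

lemma walk_mono:
  assumes "walk T \<P> e ps f" "T \<subseteq> T'" "\<P> \<subseteq> \<P>'"
  shows "walk T' \<P>' e ps f"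
  using assms
proof (induction rule: walk.induct)
  case (last Q e f)
  then show ?case by (intro walk.last) auto
next
  case (step Q e h ps f)
  then show ?case by (intro walk.step[where h = h]) auto
qed

lemma walk_set: "walk T \<P> e ps f \<Longrightarrow> set ps \<subseteq> \<P>"
  by (induction rule: walk.induct) auto

section \<open>Walks in a polygon with an ear\<close>

context ear_gluing
begin

text \<open>If both orientations were edges, \<open>V\<close> would have no third vertex.
  Consequently the unordered pair \<open>{a, b}\<close> determines the edge
  \<open>(a, b)\<close>.\<close>

lemma ab_not_reversed: "(b, a) \<notin> polygon_edges V"
proof
  assume ba: "(b, a) \<in> polygon_edges V"
  have "V \<subseteq> {a, b}"
  proof
    fix v
    assume "v \<in> V"
    then show "v \<in> {a, b}"
      using polygon_edgesD(4)[OF ba, of v] V_outside[of v] ab(1) by (auto simp: arc_iff)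
  qed
  then have "card V \<le> card {a, b}" by (intro card_mono) auto
  then show False using glued_card_ge_3[OF old] ab by simp
qed

lemma old_edge_endpoints:
  assumes "e \<in> polygon_edges V" "e \<noteq> (a, b)"
  shows "endpoints e \<noteq> {a, b}"
  using assms ab_not_reversed ab
  by (cases e) (auto simp: endpoints_def doubleton_eq_iff)

lemma new_side_ab: "{a, b} \<in> polygon_sides P"
proof -
  have "(b, a) \<in> polygon_edges P"
    using ab I by (auto simp: polygon_edges_def arc_iff)
  then show ?thesis by (force simp: polygon_sides_def endpoints_def)
qed

lemma new_side_old:
  assumes "h \<in> polygon_sides P" "h \<subseteq> V"
  shows "h = {a, b}"
  using assms I_inside(3)
  by (auto simp: polygon_sides_def polygon_edges_def endpoints_def)

lemma new_side_diagonal: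
  assumes "h \<in> polygon_sides P" "h \<in> T'"
  shows "h = {a, b}"
  using assms new_side_old inv(4) a_in b_in by blast

lemma old_side_subset:
  assumes "h \<in> polygon_sides Q" "Q \<in> \<P>"
  shows "h \<subseteq> V"
  using assms polygon_sides_subset inv(3) by blast

lemma old_edge_not_new_side:
  assumes "e \<in> polygon_edges V" "e \<noteq> (a, b)"
  shows "endpoints e \<notin> polygon_sides P"
proof
  assume "endpoints e \<in> polygon_sides P"
  moreover have "endpoints e \<subseteq> V"
    using assms by (auto simp: polygon_edges_def endpoints_def)
  ultimately show False using new_side_old old_edge_endpoints[OF assms] by blast
qed

end

text \<open>A new edge has an inner vertex of the ear and so lies on the ear alone; an old one is no
  side of the ear, and induction applies. For \<open>(a, b)\<close> this singles out the piece
  across from the ear.\<close>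

lemma boundary_piece_unique:
  assumes "glued c V T \<P>" "e \<in> polygon_edges V"
    and "Q \<in> \<P>" "Q' \<in> \<P>" "endpoints e \<in> polygon_sides Q" "endpoints e \<in> polygon_sides Q'"
  shows "Q = Q'"
  using assms
proof (induction arbitrary: e Q Q')
  case (single V)
  then show ?case by simp
next
  case (ear V T \<P> a b I)
  then interpret ear_gluing c V T \<P> a b I by unfold_locales
  obtain x y where e: "e = (x, y)" by force
  from ear.prems(1) show ?case unfolding e
  proof (cases rule: edge_cases)
    case 1
    then have "endpoints e \<notin> polygon_sides P" using old_edge_not_new_side e by blast
    then have "Q \<in> \<P>" "Q' \<in> \<P>" using ear.prems by auto
    then show ?thesis using ear.IH[of e Q Q'] ear.prems 1 e by blast
  next
    case 2
    then have "\<not> endpoints e \<subseteq> V" using I_inside(3) by (auto simp: e endpoints_def)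
    then have "Q = P" "Q' = P" using ear.prems old_side_subset by blast+
    then show ?thesis by simp
  qed
qed

context ear_gluing
begin

lemma old_piece_at_ab_unique:
  assumes "Q \<in> \<P>" "Q' \<in> \<P>" "{a, b} \<in> polygon_sides Q" "{a, b} \<in> polygon_sides Q'"
  shows "Q = Q'"
  using boundary_piece_unique[OF old ab(2) assms(1,2)] assms(3,4) by (simp add: endpoints_def)

lemma walk_in_new:
  assumes "walk T \<P> e ps f"
  shows "walk T' \<Q> e ps f" "P \<notin> set ps"
  using walk_mono[OF assms] walk_set[OF assms] P_notin by blast+

text \<open>Only \<open>Q\<close> and the ear have the side \<open>{a, b}\<close>, and
  \<open>Q\<close> is already used up.\<close>

lemma walk_from_ab:
  assumes walk: "walk T' \<Q> {a, b} ps f" and Q: "Q \<in> \<P>" "{a, b} \<in> polygon_sides Q" "Q \<notin> set ps"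
  shows "ps \<noteq> [] \<and> hd ps = P \<and> P \<in> set ps"
proof -
  have hd: "ps \<noteq> []" "hd ps \<in> \<Q>" "{a, b} \<in> polygon_sides (hd ps)"
    using walk_hd[OF walk] by auto
  then have "hd ps \<in> set ps" by simp
  then have "hd ps \<noteq> Q" using Q(3) by auto
  then have "hd ps \<notin> \<P>" using old_piece_at_ab_unique[OF Q(1) _ Q(2) hd(3)] by blast
  then show ?thesis using hd \<open>hd ps \<in> set ps\<close> by auto
qed

text \<open>An intermediate side \<open>{a, b}\<close> would force the next piece to be the ear, so
  all intermediate sides are old diagonals.\<close>

lemma walk_in_old:
  assumes "walk T' \<Q> e ps f" "P \<notin> set ps"
  shows "walk T \<P> e ps f"
  using assms
proof (induction rule: walk.induct)
  case (last Q e f)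
  then show ?case by (auto intro: walk.last)
next
  case (step Q e h ps f)
  have "h \<noteq> {a, b}"
    using walk_from_ab[of ps f Q] step.hyps step.prems by auto
  moreover have "Q \<in> \<P>" "walk T \<P> h ps f" using step by auto
  ultimately show ?case using step.hyps by (intro walk.step[where h = h]) auto
qed

text \<open>
  A walk that enters the ear through the diagonal \<open>{a, b}\<close> can only leave through it again,
  into the piece it came from.
\<close>

lemma walk_avoids_ear:
  assumes "walk T' \<Q> e ps f" "e \<notin> polygon_sides P" "f \<notin> polygon_sides P"
  shows "P \<notin> set ps"
  using assms
proof (induction rule: walk.induct)
  case (last Q e f)
  then show ?case by auto
next
  case (step Q e h ps f)
  then have Q: "Q \<noteq> P" "Q \<in> \<P>" by auto
  note Q_h = step.hyps(3) and Q_ps = step.hyps(6)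
  have "P \<notin> set ps"
  proof (cases "h \<in> polygon_sides P")
    case False
    then show ?thesis using step by blast
  next
    case True
    then have h: "h = {a, b}" using new_side_diagonal step.hyps by blast
    have hd: "hd ps = P" using walk_from_ab[of ps f Q] step.hyps(7) h Q Q_h Q_ps by simp
    from step.hyps(7) have False
    proof (cases rule: walk.cases)
      case (last Q')
      then show False using hd step.prems by simp
    next
      case (step Q' h' ps')
      then have Q': "Q' = P" using hd by simp
      then have h': "h' = {a, b}" using new_side_diagonal step by blast
      have "Q \<notin> set ps'" using Q_ps step(1) by simp
      then have "P \<in> set ps'" using walk_from_ab[of ps' f Q] step(8) h h' Q Q_h by simp
      then show False using step(7) Q' by simp
    qed
    then show ?thesis ..
  qed
  then show ?case using Q by simp
qed

lemma walk_old_old: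
  assumes "e \<notin> polygon_sides P" "f \<notin> polygon_sides P"
  shows "(\<exists>ps. walk T' \<Q> e ps f) \<longleftrightarrow> (\<exists>ps. walk T \<P> e ps f)"
proof
  assume "\<exists>ps. walk T' \<Q> e ps f"
  then obtain ps where ps: "walk T' \<Q> e ps f" ..
  then show "\<exists>ps. walk T \<P> e ps f"
    using walk_in_old[OF ps walk_avoids_ear[OF ps assms]] by blast
next
  assume "\<exists>ps. walk T \<P> e ps f"
  then show "\<exists>ps. walk T' \<Q> e ps f" using walk_in_new(1) by blast
qed

text \<open>The walk must start in the ear, whose only diagonal is \<open>{a, b}\<close>. Its
  remainder may not use the ear again and is therefore an old walk.\<close>

lemma walk_new_old:
  assumes e: "e \<in> polygon_sides P" "\<not> e \<subseteq> V" and f: "f \<notin> polygon_sides P"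
  shows "(\<exists>ps. walk T' \<Q> e ps f) \<longleftrightarrow> e \<inter> {a, b} \<noteq> {} \<and> (\<exists>ps. walk T \<P> {a, b} ps f)"
proof
  assume "\<exists>ps. walk T' \<Q> e ps f"
  then obtain ps where "walk T' \<Q> e ps f" ..
  then show "e \<inter> {a, b} \<noteq> {} \<and> (\<exists>ps. walk T \<P> {a, b} ps f)"
  proof (cases rule: walk.cases)
    case (last Q)
    then show ?thesis using e f old_side_subset by blast
  next
    case (step Q h ps')
    then have Q: "Q = P" using e old_side_subset by blast
    then have "h = {a, b}" using new_side_diagonal step by blast
    then show ?thesis using step Q walk_in_old by blast
  qed
next
  assume "e \<inter> {a, b} \<noteq> {} \<and> (\<exists>ps. walk T \<P> {a, b} ps f)"
  then obtain ps where "e \<inter> {a, b} \<noteq> {}" "walk T \<P> {a, b} ps f" by blast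
  then have "walk T' \<Q> e (P # ps) f"
    using e new_side_ab walk_in_new by (intro walk.step[where h = "{a, b}"]) auto
  then show "\<exists>ps. walk T' \<Q> e ps f" ..
qed

text \<open>Outer sides of the ear lie on no other piece, so the walk starts and ends with the ear;
  distinctness leaves a single piece.\<close>

lemma walk_new_new:
  assumes e: "e \<in> polygon_sides P" "\<not> e \<subseteq> V" and f: "f \<in> polygon_sides P" "\<not> f \<subseteq> V"
  shows "(\<exists>ps. walk T' \<Q> e ps f) \<longleftrightarrow> e \<inter> f \<noteq> {}"
proof
  assume "\<exists>ps. walk T' \<Q> e ps f"
  then obtain ps where "walk T' \<Q> e ps f" ..
  then show "e \<inter> f \<noteq> {}"
  proof (cases rule: walk.cases)
    case (step Q h ps')
    then have Q: "Q = P" using e old_side_subset by blast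
    have "ps' \<noteq> []" using walk_hd[OF step(8)] by simp
    then have "last ps' \<in> \<Q>" using walk_set[OF step(8)] last_in_set by blast
    moreover have "f \<in> polygon_sides (last ps')" by (rule walk_last[OF step(8)])
    ultimately have "last ps' = P" using f old_side_subset by blast
    then show ?thesis using step Q last_in_set[OF \<open>ps' \<noteq> []\<close>] by simp
  qed
next
  assume "e \<inter> f \<noteq> {}"
  then have "walk T' \<Q> e [P] f" using e f by (intro walk.last) auto
  then show "\<exists>ps. walk T' \<Q> e ps f" ..
qed

section \<open>Determinants across an ear\<close>

lemma path_det_old_old:
  assumes "e \<in> polygon_edges V" "f \<in> polygon_edges V"
  shows "path_det c W \<Q> e f = path_det c V \<P> e f"
  using assms path_num_old by (auto simp: path_det_def polygon_edges_def)

text \<open>By \<open>path_num_left\<close> the row of an inner vertex is the sum of the rows of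
  \<open>a\<close> and \<open>b\<close>. Replacing one of these two rows by the sum keeps the
  determinant; two inner vertices have equal rows.\<close>

lemma path_det_new_old:
  assumes x: "x = a \<or> x \<in> I" and y: "y = b \<or> y \<in> I" "x = a \<Longrightarrow> y \<noteq> b" and f: "f \<in> polygon_edges V"
  shows "path_det c W \<Q> (x, y) f =
    (if endpoints (x, y) \<inter> {a, b} \<noteq> {} then path_det c V \<P> (a, b) f else 0)"
proof -
  obtain u v where uv: "f = (u, v)" "u \<in> V" "v \<in> V" using f by (auto simp: polygon_edges_def)
  show ?thesis
    using x y uv disjoint ab path_num_left path_num_old a_in b_in
    by (auto simp: path_det_def endpoints_def algebra_simps)
qed

end

text \<open>Distinct edges differ in their first and in their second vertices, so the main diagonal
  is \<open>1, 1\<close>. The other product vanishes exactly when one edge starts where the other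
  ends.\<close>

lemma path_det_complete:
  assumes num: "\<And>x y. x \<in> P \<Longrightarrow> y \<in> P \<Longrightarrow> path_num c V \<P> x y = (if x = y then 0 else 1)"
    and "e \<in> polygon_edges P" "f \<in> polygon_edges P" "e \<noteq> f"
  shows "path_det c V \<P> e f = of_bool (endpoints e \<inter> endpoints f \<noteq> {})"
proof -
  obtain x y u v where e: "e = (x, y)" and f: "f = (u, v)" by force
  then have "x \<noteq> u" "y \<noteq> v" using assms polygon_edges_trichotomy by blast+
  moreover have "x \<in> P" "y \<in> P" "u \<in> P" "v \<in> P" using assms e f polygon_edgesD by blast+
  ultimately show ?thesis using num by (auto simp: path_det_def e f endpoints_def)
qed

theorem path_det_walk:
  assumes "glued c V T \<P>" "e \<in> polygon_edges V" "f \<in> polygon_edges V" "e \<noteq> f"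
  shows "path_det c V \<P> e f = of_bool (\<exists>ps. walk T \<P> (endpoints e) ps (endpoints f))"
  using assms
proof (induction arbitrary: e f)
  case (single V)
  have "(\<exists>ps. walk {} {V} (endpoints e) ps (endpoints f)) \<longleftrightarrow> endpoints e \<inter> endpoints f \<noteq> {}"
  proof
    assume "\<exists>ps. walk {} {V} (endpoints e) ps (endpoints f)"
    then show "endpoints e \<inter> endpoints f \<noteq> {}" by (auto elim: walk.cases)
  next
    assume "endpoints e \<inter> endpoints f \<noteq> {}"
    then have "walk {} {V} (endpoints e) [V] (endpoints f)"
      using single.prems by (intro walk.last) (auto simp: polygon_sides_def)
    then show "\<exists>ps. walk {} {V} (endpoints e) ps (endpoints f)" ..
  qed
  then show ?case
    using path_det_complete[of V c V "{V}" e f] path_num_single[of V c] single by simp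
next
  case (ear V T \<P> a b I)
  then interpret ear_gluing c V T \<P> a b I by unfold_locales
  let ?walk = "\<lambda>e f. \<exists>ps. walk T' \<Q> (endpoints e) ps (endpoints f)"
  \<comment> \<open>Stated for arbitrary \<open>e\<close> and \<open>f\<close>, since it is used
    again with the two edges exchanged; both sides are symmetric.\<close>
  have new_old: "path_det c W \<Q> e f = of_bool (?walk e f)"
    if "e = (x, y)" "(x, y) \<in> polygon_edges P" "x = a \<or> x \<in> I" "y = b \<or> y \<in> I" "x = a \<Longrightarrow> y \<noteq> b"
      and f: "f \<in> polygon_edges V" "f \<noteq> (a, b)" for e f x y
  proof -
    have "endpoints e \<in> polygon_sides P" using that by (simp add: polygon_sides_def)
    moreover have "\<not> endpoints e \<subseteq> V" using that I_inside(3) by (auto simp: endpoints_def)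
    ultimately have "?walk e f \<longleftrightarrow>
        endpoints e \<inter> {a, b} \<noteq> {} \<and> (\<exists>ps. walk T \<P> {a, b} ps (endpoints f))"
      using walk_new_old old_edge_not_new_side[OF f] by blast
    moreover have "path_det c V \<P> (a, b) f = of_bool (\<exists>ps. walk T \<P> {a, b} ps (endpoints f))"
      using ear.IH[OF ab(2) f(1)] f(2) by (simp add: endpoints_def)
    ultimately show ?thesis
      using path_det_new_old[of x y f] that by simp
  qed
  have walk_sym: "?walk e f \<longleftrightarrow> ?walk f e" for e f using walk_rev by blast
  obtain x y u v where e: "e = (x, y)" and f: "f = (u, v)" by force
  have eW: "(x, y) \<in> polygon_edges W" and fW: "(u, v) \<in> polygon_edges W"
    using ear.prems e f by auto
  from eW show ?case
  proof (cases rule: edge_cases)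
    case e': 1
    from fW show ?thesis
    proof (cases rule: edge_cases)
      case 1
      then show ?thesis
        using e' e f ear.IH[of e f] ear.prems(3) path_det_old_old[of e f]
          walk_old_old old_edge_not_new_side[of e] old_edge_not_new_side[of f] by simp
    next
      case 2
      then show ?thesis
        using new_old[OF f, of e] e' e path_det_sym[OF new ear.prems(1,2)] walk_sym[of e f] by simp
    qed
  next
    case e': 2
    from fW show ?thesis
    proof (cases rule: edge_cases)
      case 1
      then show ?thesis using new_old[OF e, of f] e' f by simp
    next
      case 2
      have "\<not> endpoints e \<subseteq> V" "\<not> endpoints f \<subseteq> V"
        using e' 2 I_inside(3) by (auto simp: e f endpoints_def)
      moreover have "e \<in> polygon_edges P" "f \<in> polygon_edges P" using e' 2 e f by auto
      ultimately show ?thesis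
        using path_det_complete[of P c W \<Q> e f] path_num_on_ear ear.prems(3)
          walk_new_new[of "endpoints e" "endpoints f"] by (simp add: polygon_sides_def)
    qed
  qed
qed

section \<open>Cutting an angulation into ears\<close>

lemma polygon_sidesE:
  assumes "h \<in> polygon_sides V"
  obtains x y where "h = {x, y}" "(x, y) \<in> polygon_edges V"
  using assms by (auto simp: polygon_sides_def endpoints_def)

lemma polygon_sides_doubleton_iff:
  "{x, y} \<in> polygon_sides V \<longleftrightarrow> (x, y) \<in> polygon_edges V \<or> (y, x) \<in> polygon_edges V"
  by (force simp: polygon_sides_def endpoints_def doubleton_eq_iff)

lemma polygon_edge_around:
  assumes "finite P" "2 \<le> card P" "v \<notin> P"
  obtains x y where "(x, y) \<in> polygon_edges P" "v \<in> arc x y"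
proof -
  have "P \<noteq> {}" using assms(2) by auto
  moreover have "p < v \<or> v < p" if "p \<in> P" for p using that assms(3) by (metis linorder_neqE_nat)
  ultimately have ne: "P \<noteq> {}" "\<And>p. p \<in> P \<Longrightarrow> p < v \<or> v < p" by auto
  \<comment> \<open>\<open>x\<close> is the last vertex of \<open>P\<close> before \<open>v\<close>
    in cyclic order: the largest one below \<open>v\<close>, or the overall maximum if none is
    below. Dually, \<open>y\<close> is the first one after \<open>v\<close>.\<close>
  obtain x where x: "x \<in> P" "\<And>p. p \<in> P \<Longrightarrow> if x < v then p < v \<longrightarrow> p \<le> x else v < p \<and> p \<le> x"
  proof (cases "\<exists>p\<in>P. p < v")
    case True
    let ?L = "{p \<in> P. p < v}"
    have fin: "finite ?L" and "?L \<noteq> {}" using True assms(1) by auto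
    then have "Max ?L \<in> ?L" by (rule Max_in)
    moreover have "p \<le> Max ?L" if "p \<in> ?L" for p using fin that by (rule Max_ge)
    ultimately show thesis using that[of "Max ?L"] by simp
  next
    case False
    then have "Max P \<in> P" "\<And>p. p \<in> P \<Longrightarrow> v < p \<and> p \<le> Max P" using ne assms(1) by auto
    moreover from this have "\<not> Max P < v" by (meson less_asym)
    ultimately show thesis using that[of "Max P"] by simp
  qed
  obtain y where y: "y \<in> P" "\<And>p. p \<in> P \<Longrightarrow> if v < y then v < p \<longrightarrow> y \<le> p else p < v \<and> y \<le> p"
  proof (cases "\<exists>p\<in>P. v < p")
    case True
    let ?G = "{p \<in> P. v < p}"
    have fin: "finite ?G" and "?G \<noteq> {}" using True assms(1) by auto
    then have "Min ?G \<in> ?G" by (rule Min_in)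
    moreover have "Min ?G \<le> p" if "p \<in> ?G" for p using fin that by (rule Min_le)
    ultimately show thesis using that[of "Min ?G"] by simp
  next
    case False
    then have "Min P \<in> P" "\<And>p. p \<in> P \<Longrightarrow> p < v \<and> Min P \<le> p" using ne assms(1) by auto
    moreover from this have "\<not> v < Min P" by (meson less_asym)
    ultimately show thesis using that[of "Min P"] by simp
  qed
  have "x \<noteq> y"
  proof
    assume "x = y"
    then have "p = x" if "p \<in> P" for p
      using x(2)[OF that] y(2)[OF that] ne(2)[OF that] x(2)[OF x(1)] y(2)[OF y(1)]
      by (auto split: if_splits)
    then have "P \<subseteq> {x}" by blast
    then have "card P \<le> 1" using card_mono[of "{x}" P] by simp
    then show False using assms(2) by simp
  qed
  moreover have "v \<in> arc x y"
    using x(2)[OF x(1)] y(2)[OF y(1)] x(2)[OF y(1)] y(2)[OF x(1)] \<open>x \<noteq> y\<close>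
    by (auto simp: arc_iff split: if_splits)
  moreover have "p \<notin> arc x y" if "p \<in> P" for p
    using x(2)[OF that] y(2)[OF that] ne(2)[OF that] x(2)[OF x(1)] y(2)[OF y(1)]
      x(2)[OF y(1)] y(2)[OF x(1)]
    by (auto simp: arc_iff split: if_splits)
  ultimately show thesis using that x(1) y(1) by (auto simp: polygon_edges_def)
qed

text \<open>The arc from \<open>x\<close> to \<open>y\<close> contains \<open>v\<close>. If the
  opposite arc were empty, \<open>P\<close> would have only two vertices. So a side of a piece that
  skips a vertex has to be a diagonal.\<close>

lemma subpolygon_edge_not_side:
  assumes "P \<subseteq> V" "3 \<le> card P" "(x, y) \<in> polygon_edges P" "v \<in> V" "v \<in> arc x y"
  shows "{x, y} \<notin> polygon_sides V"
proof
  assume "{x, y} \<in> polygon_sides V"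
  then have "arc y x \<inter> V = {}"
    using assms by (auto simp: polygon_sides_doubleton_iff polygon_edges_def)
  then have "k \<notin> arc y x" if "k \<in> P" for k using that assms(1) by blast
  then have off: "k \<notin> arc y x" "k \<notin> arc x y" if "k \<in> P" for k
    using that polygon_edgesD(4)[OF assms(3) that] by blast+
  have "k = x \<or> k = y" if "k \<in> P" for k
    using off[OF that] by (auto simp: arc_iff split: if_splits)
  then have "P \<subseteq> {x, y}" by blast
  then have "card P \<le> card {x, y}" by (intro card_mono) auto
  also have "\<dots> \<le> 2" by (simp add: card_insert_if)
  finally show False using assms(2) by simp
qed

text \<open>The counterpart of \<open>pieces\<close> for any vertex set, since a polygon without its
  ear is no longer an initial segment of labels.\<close>

definition polygon_pieces :: "nat set \<Rightarrow> nat set set \<Rightarrow> nat set set" where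
  "polygon_pieces V T = {P. P \<subseteq> V \<and> 3 \<le> card P \<and> polygon_sides P \<subseteq> T \<union> polygon_sides V \<and>
     (\<forall>z\<in>T. z \<subseteq> P \<longrightarrow> z \<in> polygon_sides P)}"

lemma polygon_piecesD:
  assumes "P \<in> polygon_pieces V T"
  shows "P \<subseteq> V" "3 \<le> card P" "\<And>h. h \<in> polygon_sides P \<Longrightarrow> h \<in> T \<or> h \<in> polygon_sides V"
    "\<And>z. z \<in> T \<Longrightarrow> z \<subseteq> P \<Longrightarrow> z \<in> polygon_sides P"
  using assms by (auto simp: polygon_pieces_def)

lemma polygon_pieces_empty:
  assumes "finite V" "3 \<le> card V"
  shows "polygon_pieces V {} = {V}"
proof -
  have "P = V" if P: "P \<in> polygon_pieces V {}" for P
  proof (rule ccontr)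
    note PD = polygon_piecesD[OF P]
    assume "P \<noteq> V"
    then obtain v where v: "v \<in> V" "v \<notin> P" using PD by auto
    have "finite P" "2 \<le> card P" using PD assms finite_subset by auto
    then obtain x y where xy: "(x, y) \<in> polygon_edges P" "v \<in> arc x y"
      using v(2) polygon_edge_around by blast
    then show False
      using subpolygon_edge_not_side[OF PD(1,2) xy(1) v(1) xy(2)] PD(3)[of "{x, y}"]
      by (simp add: polygon_sides_doubleton_iff)
  qed
  moreover have "V \<in> polygon_pieces V {}" using assms by (simp add: polygon_pieces_def)
  ultimately show ?thesis by blast
qed

text \<open>Crossing chords have interlacing labels. As all names of the endpoints and both orders
  of the two chords are quantified over, one interlacing pattern suffices.\<close>

definition noncrossing :: "nat set \<Rightarrow> nat set set \<Rightarrow> bool" where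
  "noncrossing V T \<longleftrightarrow>
     (\<forall>z\<in>T. \<exists>x y. z = {x, y} \<and> x < y \<and> x \<in> V \<and> y \<in> V \<and> arc x y \<inter> V \<noteq> {} \<and> arc y x \<inter> V \<noteq> {}) \<and>
     (\<forall>a b x y. {a, b} \<in> T \<longrightarrow> {x, y} \<in> T \<longrightarrow> \<not> (a < x \<and> x < b \<and> b < y))"

lemma noncrossingE:
  assumes "noncrossing V T" "z \<in> T"
  obtains x y where "z = {x, y}" "x < y" "x \<in> V" "y \<in> V" "arc x y \<inter> V \<noteq> {}" "arc y x \<inter> V \<noteq> {}"
  using bspec[OF conjunct1[OF assms(1)[unfolded noncrossing_def]] assms(2)] by (elim exE conjE)

lemma noncrossingD:
  assumes "noncrossing V T" "{a, b} \<in> T" "{x, y} \<in> T"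
  shows "\<not> (a < x \<and> x < b \<and> b < y)"
  using assms conjunct2[OF assms(1)[unfolded noncrossing_def]] by presburger

section \<open>The ear behind a shortest diagonal\<close>

locale shortest_diagonal =
  fixes V T a b
  assumes V: "finite V" "3 \<le> card V" and T: "noncrossing V T" and ab: "a < b" "{a, b} \<in> T"
    and shortest: "\<And>x y. x < y \<Longrightarrow> {x, y} \<in> T \<Longrightarrow> b - a \<le> y - x"
begin

abbreviation "I \<equiv> V \<inter> {a<..<b}"
abbreviation "V' \<equiv> V - I"
abbreviation "T' \<equiv> T - {{a, b}}"
abbreviation "P \<equiv> insert a (insert b I)"

lemma ab_in: "a \<in> V" "b \<in> V"
  and arcs_ab: "arc a b \<inter> V \<noteq> {}" "arc b a \<inter> V \<noteq> {}"
proof -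
  obtain x y where xy: "{a, b} = {x, y}" "x < y" "x \<in> V" "y \<in> V" "arc x y \<inter> V \<noteq> {}" "arc y x \<inter> V \<noteq> {}"
    using T ab(2) by (rule noncrossingE)
  then have "x = a" "y = b" using ab(1) by (auto simp: doubleton_eq_iff)
  then show "a \<in> V" "b \<in> V" "arc a b \<inter> V \<noteq> {}" "arc b a \<inter> V \<noteq> {}" using xy by auto
qed

lemma P_iff: "k \<in> P \<longleftrightarrow> k \<in> V \<and> a \<le> k \<and> k \<le> b"
  using ab_in ab(1) by auto

text \<open>A diagonal with an end strictly between \<open>a\<close> and \<open>b\<close> cannot
  leave the interval without crossing, so it would be shorter than \<open>{a, b}\<close>. Length as
  a difference of labels is enough for this.\<close>

lemma diagonal_cases:
  assumes "{x, y} \<in> T" "x < y"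
  shows "x \<le> a \<or> b \<le> x" "y \<le> a \<or> b \<le> y" "x \<in> V" "y \<in> V" "arc x y \<inter> V \<noteq> {}" "arc y x \<inter> V \<noteq> {}"
proof -
  have nc: "\<not> (a < x \<and> x < b \<and> b < y)" "\<not> (x < a \<and> a < y \<and> y < b)"
    using noncrossingD[OF T ab(2) assms(1)] noncrossingD[OF T assms(1) ab(2)] by auto
  then show "x \<le> a \<or> b \<le> x" "y \<le> a \<or> b \<le> y"
    using shortest[OF assms(2,1)] assms(2) by linarith+
  obtain u v where "{x, y} = {u, v}" "u < v" "u \<in> V" "v \<in> V" "arc u v \<inter> V \<noteq> {}" "arc v u \<inter> V \<noteq> {}"
    using T assms(1) by (rule noncrossingE)
  then show "x \<in> V" "y \<in> V" "arc x y \<inter> V \<noteq> {}" "arc y x \<inter> V \<noteq> {}"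
    using assms(2) by (auto simp: doubleton_eq_iff)
qed

lemma diagonalE:
  assumes "z \<in> T"
  obtains x y where "z = {x, y}" "x < y"
  using noncrossingE[OF T assms] by metis

lemma ab_edge: "(a, b) \<in> polygon_edges V'"
  using ab ab_in by (auto simp: polygon_edges_def arc_iff)

lemma ab_edge_P: "(b, a) \<in> polygon_edges P"
  using ab by (auto simp: polygon_edges_def arc_iff)

lemma I_nonempty: "I \<noteq> {}"
  using arcs_ab(1) ab(1) by (auto simp: arc_def)

lemma card_V': "3 \<le> card V'"
proof -
  obtain k where k: "k \<in> arc b a \<inter> V" using arcs_ab by blast
  then have "{a, b, k} \<subseteq> V'" "card {a, b, k} = 3"
    using ab ab_in by (auto simp: arc_iff)
  then show ?thesis using V(1) by (metis card_mono finite_Diff)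
qed

lemma noncrossing_V': "noncrossing V' T'"
  unfolding noncrossing_def
proof (intro conjI)
  show "\<forall>z\<in>T'. \<exists>x y. z = {x, y} \<and> x < y \<and> x \<in> V' \<and> y \<in> V' \<and> arc x y \<inter> V' \<noteq> {} \<and> arc y x \<inter> V' \<noteq> {}"
  proof
    fix z
    assume z: "z \<in> T'"
    then obtain x y where xy: "z = {x, y}" "x < y" using diagonalE by blast
    then have d: "{x, y} \<in> T" using z by simp
    note D = diagonal_cases[OF d xy(2)]
    have ne: "x \<noteq> a \<or> y \<noteq> b" using z xy by auto
    obtain k where k: "k \<in> arc x y" "k \<in> V" using D(5) by blast
    \<comment> \<open>If the witness \<open>k\<close> is cut off with the ear, then
      \<open>x \<le> a\<close> and \<open>b \<le> y\<close>, not both with equality, so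
      \<open>a\<close> or \<open>b\<close> replaces it.\<close>
    have "\<exists>k'\<in>{k, a, b}. k' \<in> arc x y \<inter> V'"
      using k D(1,2) ne xy(2) ab(1) ab_in by (auto simp: arc_iff)
    moreover obtain l where l: "l \<in> arc y x" "l \<in> V" using D(6) by blast
    have "\<exists>l'\<in>{l, a, b}. l' \<in> arc y x \<inter> V'"
      using l D(1,2) ne xy(2) ab(1) ab_in by (auto simp: arc_iff)
    ultimately have "arc x y \<inter> V' \<noteq> {}" "arc y x \<inter> V' \<noteq> {}" by blast+
    moreover have "x \<in> V'" "y \<in> V'" using D by auto
    ultimately show "\<exists>x y. z = {x, y} \<and> x < y \<and> x \<in> V' \<and> y \<in> V' \<and> arc x y \<inter> V' \<noteq> {} \<and> arc y x \<inter> V' \<noteq> {}"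
      using xy by blast
  qed
  show "\<forall>a' b' x y. {a', b'} \<in> T' \<longrightarrow> {x, y} \<in> T' \<longrightarrow> \<not> (a' < x \<and> x < b' \<and> b' < y)"
    using T unfolding noncrossing_def by blast
qed

text \<open>Neighbours in the interval are neighbours in \<open>V\<close>, the closing side is
  \<open>{a, b}\<close> itself, and no other diagonal has both ends in the interval.\<close>

lemma P_piece: "P \<in> polygon_pieces V T"
proof -
  obtain w where w: "w \<in> I" using I_nonempty by blast
  then have "{a, b, w} \<subseteq> P" "card {a, b, w} = 3" using ab by auto
  then have "3 \<le> card P" using V(1) by (metis card_mono finite_Int finite_insert)
  moreover have "h \<in> T \<union> polygon_sides V" if h: "h \<in> polygon_sides P" for h
  proof -
    obtain x y where xy: "h = {x, y}" "(x, y) \<in> polygon_edges P" using h by (rule polygon_sidesE)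
    note D = polygon_edgesD[OF xy(2)]
    show ?thesis
    proof (cases "x < y")
      case True
      then have "k \<notin> arc x y" if "k \<in> V" for k
        using D(1,2) D(4)[of k] that unfolding P_iff by (auto simp: arc_iff)
      then have "(x, y) \<in> polygon_edges V" using D P_iff by (auto simp: polygon_edges_def)
      then show ?thesis using xy by (auto simp: polygon_sides_doubleton_iff)
    next
      case False
      have "a \<notin> arc x y" "b \<notin> arc x y" using D(4) by auto
      then have "x = b" "y = a" using False D(1,2) unfolding P_iff by (auto simp: arc_iff)
      then show ?thesis using xy ab by (simp add: insert_commute)
    qed
  qed
  moreover have "z \<in> polygon_sides P" if z: "z \<in> T" "z \<subseteq> P" for z
  proof -
    obtain x y where xy: "z = {x, y}" "x < y" using z(1) by (rule diagonalE)
    then have "{x, y} \<in> T" "x \<in> P" "y \<in> P" using z by auto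
    then have "x = a" "y = b"
      using diagonal_cases(1,2)[of x y] xy(2) P_iff[of x] P_iff[of y] by linarith+
    then show ?thesis using ab_edge_P xy by (simp add: polygon_sides_doubleton_iff)
  qed
  ultimately show ?thesis using ab_in by (auto simp: polygon_pieces_def)
qed

text \<open>
  A gap of \<open>Q\<close> between \<open>a\<close> and \<open>b\<close> would be closed by a diagonal shorter than \<open>{a, b}\<close>, so \<open>Q\<close>
  contains all of \<open>P\<close>, and then \<open>{a, b}\<close> is a side of \<open>Q\<close>.
\<close>

lemma piece_meeting_I:
  assumes Q: "Q \<in> polygon_pieces V T" and q: "q \<in> Q" "q \<in> I"
  shows "Q = P"
proof -
  note QD = polygon_piecesD[OF Q]
  have finQ: "finite Q" using QD(1) V(1) finite_subset by blast
  have "v \<in> Q" if v: "v \<in> P" for v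
  proof (rule ccontr)
    assume "v \<notin> Q"
    then obtain x y where xy: "(x, y) \<in> polygon_edges Q" "v \<in> arc x y"
      using finQ QD(2) polygon_edge_around[of Q v] by auto
    have "v \<in> V" using v P_iff by simp
    then have "{x, y} \<notin> polygon_sides V" using subpolygon_edge_not_side[OF QD(1,2) xy(1)] xy(2) by blast
    then have d: "{x, y} \<in> T" using QD(3)[of "{x, y}"] xy(1) by (simp add: polygon_sides_doubleton_iff)
    have "x < y \<or> y < x" using polygon_edgesD(3)[OF xy(1)] by auto
    then have "x \<le> a \<or> b \<le> x" "y \<le> a \<or> b \<le> y"
      using diagonal_cases(1,2)[of x y] diagonal_cases(1,2)[of y x] d by (auto simp: insert_commute)
    moreover have "q \<notin> arc x y" using polygon_edgesD(4)[OF xy(1) q(1)] .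
    moreover have "a < q" "q < b" "a \<le> v" "v \<le> b" using q v P_iff by auto
    ultimately show False using xy(2) polygon_edgesD(3)[OF xy(1)] by (auto simp: arc_iff split: if_splits)
  qed
  then have PQ: "P \<subseteq> Q" by blast
  then have "{a, b} \<in> polygon_sides Q" using QD(4) ab(2) by simp
  then have "(a, b) \<in> polygon_edges Q \<or> (b, a) \<in> polygon_edges Q"
    by (simp add: polygon_sides_doubleton_iff)
  moreover have "(a, b) \<notin> polygon_edges Q"
    using q ab(1) by (auto simp: polygon_edges_def arc_iff)
  ultimately have ba: "(b, a) \<in> polygon_edges Q" by blast
  have "k \<in> P" if "k \<in> Q" for k
    using polygon_edgesD(4)[OF ba that] that QD(1) ab(1) unfolding P_iff by (auto simp: arc_iff)
  then show ?thesis using PQ by blast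
qed

lemma edge_V':
  assumes "(x, y) \<in> polygon_edges V'"
  shows "(x, y) \<in> polygon_edges V \<or> (x, y) = (a, b)"
proof (rule ccontr)
  note D = polygon_edgesD[OF assms]
  assume not: "\<not> ?thesis"
  then obtain v where v: "v \<in> V" "v \<in> arc x y" using D by (auto simp: polygon_edges_def)
  then have "v \<in> I" using D(4)[of v] by blast
  moreover have "a \<notin> arc x y" "b \<notin> arc x y" using D(4) ab_in by auto
  moreover have "x \<le> a \<or> b \<le> x" "y \<le> a \<or> b \<le> y" using D(1,2) by auto
  ultimately have "(x, y) = (a, b)" using v(2) D(3) ab(1) by (auto simp: arc_iff split: if_splits)
  then show False using not by blast
qed

text \<open>Cutting turns \<open>{a, b}\<close> from a diagonal into a boundary side, and either
  role allows it as a side of a piece.\<close>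

lemma pieces_V': "polygon_pieces V T = insert P (polygon_pieces V' T')"
proof (rule set_eqI, rule iffI)
  fix Q
  assume Q: "Q \<in> polygon_pieces V T"
  note QD = polygon_piecesD[OF Q]
  show "Q \<in> insert P (polygon_pieces V' T')"
  proof (cases "Q = P")
    case False
    then have QV: "Q \<subseteq> V'" using piece_meeting_I[OF Q] QD(1) by blast
    have "h \<in> T' \<union> polygon_sides V'" if h: "h \<in> polygon_sides Q" for h
    proof -
      obtain x y where xy: "h = {x, y}" "(x, y) \<in> polygon_edges Q" using h by (rule polygon_sidesE)
      have "x \<in> V'" "y \<in> V'" using xy polygon_edgesD QV by blast+
      then have "h \<in> polygon_sides V'" if "h \<in> polygon_sides V"
        using that xy by (auto simp: polygon_sides_doubleton_iff polygon_edges_def)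
      moreover have "{a, b} \<in> polygon_sides V'"
        using ab_edge by (simp add: polygon_sides_doubleton_iff)
      ultimately show ?thesis using QD(3)[OF h] by blast
    qed
    then show ?thesis using QD QV by (auto simp: polygon_pieces_def)
  qed simp
next
  fix Q
  assume "Q \<in> insert P (polygon_pieces V' T')"
  then show "Q \<in> polygon_pieces V T"
  proof
    assume Q: "Q \<in> polygon_pieces V' T'"
    note QD = polygon_piecesD[OF Q]
    have "h \<in> T \<union> polygon_sides V" if h: "h \<in> polygon_sides Q" for h
      using QD(3)[OF h]
    proof
      assume "h \<in> polygon_sides V'"
      then obtain x y where "h = {x, y}" "(x, y) \<in> polygon_edges V'" by (rule polygon_sidesE)
      then show ?thesis using edge_V'[of x y] ab(2) by (auto simp: polygon_sides_doubleton_iff)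
    qed blast
    moreover have "z \<in> polygon_sides Q" if z: "z \<in> T" "z \<subseteq> Q" for z
    proof (cases "z = {a, b}")
      case True
      then have "(a, b) \<in> polygon_edges Q" using z QD(1) ab by (auto simp: polygon_edges_def arc_iff)
      then show ?thesis using True by (simp add: polygon_sides_doubleton_iff)
    next
      case False
      then show ?thesis using QD(4) z by blast
    qed
    ultimately show ?thesis using QD by (auto simp: polygon_pieces_def)
  qed (simp add: P_piece)
qed

end

lemma exists_shortest_diagonal:
  assumes "noncrossing V T" "T \<noteq> {}"
  obtains a b where "a < b" "{a, b} \<in> T" "\<And>x y. x < y \<Longrightarrow> {x, y} \<in> T \<Longrightarrow> b - a \<le> y - x"
proof -
  obtain z where "z \<in> T" using assms(2) by blast
  then obtain x y where "x < y \<and> {x, y} \<in> T" using noncrossingE[OF assms(1)] by metis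
  then have "\<exists>p. fst p < snd p \<and> {fst p, snd p} \<in> T" by (intro exI[of _ "(x, y)"]) simp
  then obtain p where p: "fst p < snd p \<and> {fst p, snd p} \<in> T"
    "\<forall>q. fst q < snd q \<and> {fst q, snd q} \<in> T \<longrightarrow> snd p - fst p \<le> snd q - fst q"
    using ex_has_least_nat[of "\<lambda>p. fst p < snd p \<and> {fst p, snd p} \<in> T" _ "\<lambda>p. snd p - fst p"] by blast
  show thesis
  proof (rule that[of "fst p" "snd p"])
    fix x y :: nat
    assume "x < y" "{x, y} \<in> T"
    then show "snd p - fst p \<le> y - x" using spec[OF p(2), of "(x, y)"] by simp
  qed (use p(1) in auto)
qed

text \<open>Induction on the number of vertices. By \<open>pieces_V'\<close> the size condition
  passes to the smaller polygon, and for the ear it gives \<open>card I = c\<close>.\<close>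

theorem glued_polygon_pieces:
  assumes "0 < c" "finite V" "3 \<le> card V" "noncrossing V T" "\<forall>P\<in>polygon_pieces V T. card P = c + 2"
  shows "glued c V T (polygon_pieces V T)"
  using assms(2-)
proof (induction "card V" arbitrary: V T rule: less_induct)
  case less
  show ?case
  proof (cases "T = {}")
    case True
    then show ?thesis
      using polygon_pieces_empty[OF less.prems(1,2)] less.prems assms(1) glued.single by auto
  next
    case False
    then obtain a b where ab: "a < b" "{a, b} \<in> T" "\<And>x y. x < y \<Longrightarrow> {x, y} \<in> T \<Longrightarrow> b - a \<le> y - x"
      using exists_shortest_diagonal[OF less.prems(3)] by metis
    then interpret shortest_diagonal V T a b using less.prems by unfold_locales
    have "card V' < card V" using I_nonempty V(1) by (intro psubset_card_mono) auto
    then have glued: "glued c V' T' (polygon_pieces V' T')"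
      using less.prems card_V' noncrossing_V' pieces_V' by (intro less.hyps) auto
    have "card P = c + 2" using less.prems(4) P_piece by blast
    then have "card I = c" using V(1) ab(1) by simp
    then have "glued c (V' \<union> I) (insert {a, b} T') (insert P (polygon_pieces V' T'))"
      using glued ab(1) ab_edge by (intro glued.ear) auto
    moreover have "V' \<union> I = V" "insert {a, b} T' = T" using ab(2) by auto
    ultimately show ?thesis using pieces_V' by simp
  qed
qed

section \<open>Translation to the given definitions\<close>

definition edge_path ::
  "nat set set \<Rightarrow> nat set set \<Rightarrow> nat \<Rightarrow> (nat \<Rightarrow> nat set) \<Rightarrow> (nat \<Rightarrow> nat set) \<Rightarrow> bool" where
  "edge_path T \<P> s z p \<longleftrightarrow>
     (\<forall>k. 1 \<le> k \<and> k < s \<longrightarrow> z k \<in> T) \<and>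
     (\<forall>k<s. p k \<in> \<P> \<and> z k \<in> polygon_sides (p k) \<and> z (k + 1) \<in> polygon_sides (p k)) \<and>
     inj_on p {..<s} \<and> (\<forall>k<s. z k \<inter> z (k + 1) \<noteq> {})"

lemma edge_path_1:
  "edge_path T \<P> 1 z p \<longleftrightarrow> p 0 \<in> \<P> \<and> z 0 \<in> polygon_sides (p 0) \<and> z 1 \<in> polygon_sides (p 0) \<and>
     z 0 \<inter> z 1 \<noteq> {}"
  by (auto simp: edge_path_def inj_on_def)

lemma edge_path_Suc:
  assumes "1 \<le> s"
  shows "edge_path T \<P> (Suc s) z p \<longleftrightarrow>
     p 0 \<in> \<P> \<and> z 0 \<in> polygon_sides (p 0) \<and> z 1 \<in> polygon_sides (p 0) \<and> z 0 \<inter> z 1 \<noteq> {} \<and>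
     z 1 \<in> T \<and> p 0 \<notin> (\<lambda>k. p (Suc k)) ` {..<s} \<and> edge_path T \<P> s (\<lambda>k. z (Suc k)) (\<lambda>k. p (Suc k))"
proof -
  have "(\<forall>k. 1 \<le> k \<and> k < Suc s \<longrightarrow> z k \<in> T) \<longleftrightarrow> z 1 \<in> T \<and> (\<forall>k. 1 \<le> k \<and> k < s \<longrightarrow> z (Suc k) \<in> T)"
    (is "?l \<longleftrightarrow> ?r")
  proof
    assume ?l
    then show ?r using assms by auto
  next
    assume r: ?r
    show ?l
    proof (intro allI impI)
      fix k
      assume "1 \<le> k \<and> k < Suc s"
      then show "z k \<in> T" using r by (cases k; cases "k - 1") auto
    qed
  qed
  moreover have "inj_on p {..<Suc s} \<longleftrightarrow>
      p 0 \<notin> (\<lambda>k. p (Suc k)) ` {..<s} \<and> inj_on (\<lambda>k. p (Suc k)) {..<s}"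
    unfolding lessThan_Suc_eq_insert_0 by (auto simp: inj_on_def)
  ultimately show ?thesis
    unfolding edge_path_def by (auto simp: All_less_Suc2)
qed

text \<open>The clause on the image of \<open>p\<close> is what turns
  \<open>Q \<notin> set ps\<close> into injectivity when a piece is prepended.\<close>

lemma walk_edge_path:
  assumes "walk T \<P> e ps f"
  shows "\<exists>s z p. 1 \<le> s \<and> z 0 = e \<and> z s = f \<and> p ` {..<s} = set ps \<and> edge_path T \<P> s z p"
  using assms
proof (induction rule: walk.induct)
  case (last Q e f)
  show ?case
  proof (intro exI conjI)
    show "edge_path T \<P> 1 (\<lambda>k. if k = 0 then e else f) (\<lambda>_. Q)"
      unfolding edge_path_1 using last by simp
  qed auto
next
  case (step Q e h ps f)
  then obtain s z p where *: "1 \<le> s" "z 0 = h" "z s = f" "p ` {..<s} = set ps" "edge_path T \<P> s z p"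
    by blast
  show ?case
  proof (intro exI conjI)
    show "edge_path T \<P> (Suc s) (case_nat e z) (case_nat Q p)"
      unfolding edge_path_Suc[OF *(1)] using * step.hyps by simp
    show "case_nat Q p ` {..<Suc s} = set (Q # ps)"
      using *(4) by (simp add: lessThan_Suc_eq_insert_0 image_image)
  qed (use * in auto)
qed

lemma edge_path_walk:
  assumes "1 \<le> s" "edge_path T \<P> s z p"
  shows "\<exists>ps. set ps = p ` {..<s} \<and> walk T \<P> (z 0) ps (z s)"
  using assms
proof (induction s arbitrary: z p rule: nat_induct_at_least)
  case base
  then have "walk T \<P> (z 0) [p 0] (z 1)"
    unfolding edge_path_1 by (intro walk.last) auto
  then show ?case by (intro exI[of _ "[p 0]"]) (simp add: lessThan_Suc)
next
  case (Suc s)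
  note path = Suc.prems[unfolded edge_path_Suc[OF Suc.hyps]]
  then obtain ps where ps: "set ps = (\<lambda>k. p (Suc k)) ` {..<s}" "walk T \<P> (z 1) ps (z (Suc s))"
    using Suc.IH[of "\<lambda>k. z (Suc k)" "\<lambda>k. p (Suc k)"] by auto
  then have "walk T \<P> (z 0) (p 0 # ps) (z (Suc s))"
    using path by (intro walk.step[where h = "z 1"]) auto
  moreover have "set (p 0 # ps) = p ` {..<Suc s}"
    using ps(1) by (simp add: lessThan_Suc_eq_insert_0 image_image)
  ultimately show ?case by blast
qed

lemma walk_iff_edge_path:
  "(\<exists>ps. walk T \<P> e ps f) \<longleftrightarrow> (\<exists>s z p. 1 \<le> s \<and> z 0 = e \<and> z s = f \<and> edge_path T \<P> s z p)"
  using walk_edge_path[of T \<P> e _ f] edge_path_walk[of _ T \<P>] by metis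

section \<open>Residues modulo \<open>n\<close> and intervals of labels\<close>

lemma strictly_between_eq_arc:
  assumes "i < n" "j < n"
  shows "strictly_between n i j = arc i j \<inter> {..<n}"
proof (intro set_eqI iffI)
  fix k
  assume "k \<in> strictly_between n i j"
  then obtain t where t: "k = (i + t) mod n" "0 < t" "t < ccw_steps n i j"
    by (auto simp: strictly_between_def)
  \<comment> \<open>For \<open>i = j\<close> the second branch gives \<open>n\<close>, the full
    turn.\<close>
  have steps: "ccw_steps n i j = (if i < j then j - i else j + n - i)"
    using assms by (auto simp: ccw_steps_def le_mod_geq)
  then have "k = (if i + t < n then i + t else i + t - n)"
    using t assms by (auto simp: le_mod_geq split: if_splits)
  then show "k \<in> arc i j \<inter> {..<n}"
    using t(2,3) steps assms by (auto simp: arc_iff split: if_splits)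
next
  fix k
  assume k: "k \<in> arc i j \<inter> {..<n}"
  have steps: "ccw_steps n i j = (if i < j then j - i else j + n - i)"
    using assms by (auto simp: ccw_steps_def le_mod_geq)
  define t where "t = (if i < k then k - i else k + n - i)"
  have "k = (i + t) mod n" "0 < t" "t < ccw_steps n i j"
    using k steps assms by (auto simp: arc_iff t_def split: if_splits)
  then show "k \<in> strictly_between n i j" by (auto simp: strictly_between_def)
qed

lemma boundary_edges_eq:
  assumes "2 \<le> n"
  shows "boundary_edges n = polygon_edges {..<n}"
proof (intro set_eqI iffI)
  fix e
  assume "e \<in> boundary_edges n"
  then obtain i where i: "e = (i, (i + 1) mod n)" "i < n" by (auto simp: boundary_edges_def)
  show "e \<in> polygon_edges {..<n}"
  proof (cases "i + 1 < n")
    case True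
    then show ?thesis using i by (auto simp: polygon_edges_def arc_iff)
  next
    case False
    then have "i + 1 = n" using i by simp
    then show ?thesis using i assms by (auto simp: polygon_edges_def arc_iff)
  qed
next
  fix e
  assume "e \<in> polygon_edges {..<n}"
  then obtain x y where e: "e = (x, y)" "(x, y) \<in> polygon_edges {..<n}" by (cases e) auto
  note D = polygon_edgesD[OF e(2)]
  \<comment> \<open>The residue after \<open>x\<close> is \<open>x + 1\<close>, or \<open>0\<close>
    at the last label; not being inside the arc, it must be \<open>y\<close>.\<close>
  have "x + 1 < n \<Longrightarrow> x + 1 \<notin> arc x y" "0 \<notin> arc x y" using D(4) assms by auto
  then have "y = (x + 1) mod n"
    using D(1-3) by (cases "x + 1 < n") (auto simp: arc_iff split: if_splits, metis Suc_lessI mod_self)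
  then show "e \<in> boundary_edges n" using e D(1) by (auto simp: boundary_edges_def)
qed

lemma sides_eq:
  assumes "P \<subseteq> {..<n}"
  shows "sides n P = polygon_sides P"
proof -
  have between: "strictly_between n x y \<inter> P = arc x y \<inter> P" if "x \<in> P" "y \<in> P" for x y
    using strictly_between_eq_arc[of x n y] that assms by auto
  have "h \<in> sides n P \<longleftrightarrow> (\<exists>x y. h = {x, y} \<and> (x, y) \<in> polygon_edges P)" for h
    unfolding sides_def polygon_edges_def using between by (simp cong: conj_cong)
  moreover have "h \<in> polygon_sides P \<longleftrightarrow> (\<exists>x y. h = {x, y} \<and> (x, y) \<in> polygon_edges P)" for h
    by (force simp: polygon_sides_def endpoints_def)
  ultimately show ?thesis by (simp add: set_eq_iff)
qed

lemma pieces_eq: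
  assumes "2 \<le> n"
  shows "pieces n T = polygon_pieces {..<n} T"
  unfolding pieces_def polygon_pieces_def boundary_edges_eq[OF assms] polygon_sides_def[symmetric]
  by (auto simp: sides_eq)

lemma dissection_noncrossing:
  assumes "2 \<le> n" "dissection n T"
  shows "noncrossing {..<n} T"
proof -
  have sub: "z \<in> diagonals n" if "z \<in> T" for z using assms(2) that by (auto simp: dissection_def)
  have "\<exists>x y. z = {x, y} \<and> x < y \<and> x \<in> {..<n} \<and> y \<in> {..<n} \<and> arc x y \<inter> {..<n} \<noteq> {} \<and> arc y x \<inter> {..<n} \<noteq> {}"
    if zT: "z \<in> T" for z
  proof -
    obtain u v where uv: "z = {u, v}" "u < n" "v < n" "u \<noteq> v"
      using sub[OF zT] by (auto simp: diagonals_def)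
    then obtain x y where xy: "z = {x, y}" "x < n" "y < n" "x < y"
      by (metis insert_commute linorder_neqE_nat)
    have "z \<notin> polygon_sides {..<n}"
      using sub[OF zT] boundary_edges_eq[OF assms(1)] by (simp add: diagonals_def polygon_sides_def)
    then show ?thesis
      using xy by (intro exI[of _ x] exI[of _ y])
        (auto simp: polygon_sides_doubleton_iff polygon_edges_def)
  qed
  moreover have "\<not> (a < x \<and> x < b \<and> b < y)" if "{a, b} \<in> T" "{x, y} \<in> T" for a b x y
  proof
    assume less: "a < x \<and> x < b \<and> b < y"
    have "y < n" using sub[OF that(2)] by (auto simp: diagonals_def doubleton_eq_iff)
    then have "x \<in> strictly_between n a b" "y \<in> strictly_between n b a"
      using less by (simp_all add: strictly_between_eq_arc arc_iff)
    then have "crossing n {a, b} {x, y}" by (auto simp: crossing_def)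
    then show False using assms(2) that by (auto simp: dissection_def)
  qed
  ultimately show ?thesis by (simp add: noncrossing_def)
qed

lemma num_paths_eq:
  assumes "i < n" "j < n"
  shows "num_paths n d T i j = path_num (d - 2) {..<n} (pieces n T) i j"
  using assms
  by (simp add: num_paths_def d_paths_def path_num_def assign_count_def assignments_def
    strictly_between_eq_arc)

lemma edge_det_eq:
  assumes "e \<in> boundary_edges n" "f \<in> boundary_edges n"
  shows "edge_det n d T e f = path_det (d - 2) {..<n} (pieces n T) e f"
proof -
  have "fst e < n" "snd e < n" "fst f < n" "snd f < n"
    using assms by (auto simp: boundary_edges_def)
  then show ?thesis
    by (simp add: edge_det_def det_2 path_det_def num_paths_eq)
qed

theorem theorem5p1:
  fixes d m n :: nat and T :: "nat set set"
  assumes "3 \<le> d" and "n = d + m * (d - 2)" and "angulation n d T"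
  shows "(\<forall>e\<in>boundary_edges n. edge_det n d T e e = - 1) \<and>
    (\<forall>e\<in>boundary_edges n. \<forall>f\<in>boundary_edges n. e \<noteq> f \<longrightarrow> edge_det n d T e f \<in> {0, 1}) \<and>
    (\<forall>e\<in>boundary_edges n. \<forall>f\<in>boundary_edges n. e \<noteq> f \<longrightarrow>
      (edge_det n d T e f = 1 \<longleftrightarrow>
        (\<exists>(s :: nat) (z :: nat \<Rightarrow> nat set) (p :: nat \<Rightarrow> nat set).
           1 \<le> s \<and> z 0 = endpoints e \<and> z s = endpoints f \<and>
           (\<forall>k. 1 \<le> k \<and> k < s \<longrightarrow> z k \<in> T) \<and>
           (\<forall>k<s. p k \<in> pieces n T \<and> z k \<in> sides n (p k) \<and> z (k + 1) \<in> sides n (p k)) \<and>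
           inj_on p {..<s} \<and>
           (\<forall>k<s. z k \<inter> z (k + 1) \<noteq> {}))))"
proof -
  let ?V = "{..<n}" and ?\<P> = "pieces n T"
  have n: "3 \<le> n" using assms(1,2) by simp
  then have edges: "boundary_edges n = polygon_edges ?V" and pieces: "?\<P> = polygon_pieces ?V T"
    using boundary_edges_eq pieces_eq by auto
  have "glued (d - 2) ?V T ?\<P>"
    unfolding pieces using assms n dissection_noncrossing[of n T] pieces
    by (intro glued_polygon_pieces) (auto simp: angulation_def)
  note glued = this
  have self: "edge_det n d T e e = - 1" if "e \<in> boundary_edges n" for e
    using path_det_self[OF glued] that edges edge_det_eq[OF that that] by simp
  have walk: "edge_det n d T e f = of_bool (\<exists>ps. walk T ?\<P> (endpoints e) ps (endpoints f))"
    if "e \<in> boundary_edges n" "f \<in> boundary_edges n" "e \<noteq> f" for e f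
    using path_det_walk[OF glued] that edges edge_det_eq[OF that(1,2)] by simp
  have "sides n P = polygon_sides P" if "P \<in> ?\<P>" for P
    using that by (intro sides_eq) (simp add: pieces_def)
  then have path: "edge_path T ?\<P> s z p \<longleftrightarrow> (\<forall>k. 1 \<le> k \<and> k < s \<longrightarrow> z k \<in> T) \<and>
      (\<forall>k<s. p k \<in> ?\<P> \<and> z k \<in> sides n (p k) \<and> z (k + 1) \<in> sides n (p k)) \<and>
      inj_on p {..<s} \<and> (\<forall>k<s. z k \<inter> z (k + 1) \<noteq> {})" for s z p
    unfolding edge_path_def by (simp cong: conj_cong)
  show ?thesis
  proof (intro conjI ballI impI)
    fix e f
    assume ef: "e \<in> boundary_edges n" "f \<in> boundary_edges n" "e \<noteq> f"
    show "edge_det n d T e f \<in> {0, 1}" unfolding walk[OF ef] by auto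
    show "edge_det n d T e f = 1 \<longleftrightarrow>
        (\<exists>(s :: nat) (z :: nat \<Rightarrow> nat set) (p :: nat \<Rightarrow> nat set).
           1 \<le> s \<and> z 0 = endpoints e \<and> z s = endpoints f \<and>
           (\<forall>k. 1 \<le> k \<and> k < s \<longrightarrow> z k \<in> T) \<and>
           (\<forall>k<s. p k \<in> pieces n T \<and> z k \<in> sides n (p k) \<and> z (k + 1) \<in> sides n (p k)) \<and>
           inj_on p {..<s} \<and> (\<forall>k<s. z k \<inter> z (k + 1) \<noteq> {}))"
      by (simp only: walk[OF ef] walk_iff_edge_path path of_bool_eq_1_iff)
  qed (rule self)
qed

end
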